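(* The function $\xi$ which assigns to a finite poset $P=(X,\prec)$ with $|X|=n$ the value $$\xi(P)\ :=\ e(P)\cdot\prod_{x\in X}b(x)\ -\ n!$$ (a nonnegative integer) is in the complexity class $\#\mathrm{P}$.
   Context: $e(P)$ is the number of linear extensions of $P$ (bijections $f:X\to[n]$ with $f(x)<f(y)$ whenever $x\prec y$), and $b(x):=|\{y\in X:y\succcurlyeq x\}|$. $\#\mathrm{P}$ is the class of functions that count the number of witnesses of a relation whose membership can be decided in polynomial time (in the size of the input poset). *)

theory Defs
  imports Complex_Main "HOL-Library.FuncSet" "HOL-Computational_Algebra.Polynomial"
begin

section \<open>Finite posets, linear extensions and the function \<open>\<xi>\<close>\<close>

text \<open>A poset is given by its ground set and its strict order; \<open>r\<close> is only relevant on \<open>X\<close>.\<close>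

definition finite_poset :: "'a set \<Rightarrow> ('a \<Rightarrow> 'a \<Rightarrow> bool) \<Rightarrow> bool" where
  "finite_poset X r \<longleftrightarrow> finite X \<and> irreflp_on X r \<and> transp_on X r"

text \<open>Linear extensions are taken extensional, so that each of them is counted once.\<close>

definition linear_extensions :: "'a set \<Rightarrow> ('a \<Rightarrow> 'a \<Rightarrow> bool) \<Rightarrow> ('a \<Rightarrow> nat) set" where
  "linear_extensions X r =
     {f \<in> extensional X. bij_betw f X {1..card X} \<and> (\<forall>x\<in>X. \<forall>y\<in>X. r x y \<longrightarrow> f x < f y)}"

definition num_linext :: "'a set \<Rightarrow> ('a \<Rightarrow> 'a \<Rightarrow> bool) \<Rightarrow> nat" where
  "num_linext X r = card (linear_extensions X r)"

definition upper_size :: "'a set \<Rightarrow> ('a \<Rightarrow> 'a \<Rightarrow> bool) \<Rightarrow> 'a \<Rightarrow> nat" where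
  "upper_size X r x = card {y \<in> X. y = x \<or> r x y}"

definition xi :: "'a set \<Rightarrow> ('a \<Rightarrow> 'a \<Rightarrow> bool) \<Rightarrow> int" where
  "xi X r = int (num_linext X r) * (\<Prod>x\<in>X. int (upper_size X r x)) - fact (card X)"

text \<open>
  \<open>\<xi>\<close> is an isomorphism invariant, so nothing is lost by taking the ground sets of
  encoded posets to be initial segments of the natural numbers.
\<close>

lemma xi_iso:
  assumes h: "bij_betw h Y X"
  shows "xi Y (\<lambda>i j. r (h i) (h j)) = xi X r"
proof -
  let ?s = "\<lambda>i j. r (h i) (h j)"
  let ?g = "the_inv_into Y h"
  have inj: "inj_on h Y" and im: "h ` Y = X"
    using h by (auto simp: bij_betw_def)
  have gh: "\<And>y. y \<in> Y \<Longrightarrow> ?g (h y) = y"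
    using inj by (simp add: the_inv_into_f_f)
  have hg: "\<And>x. x \<in> X \<Longrightarrow> h (?g x) = x \<and> ?g x \<in> Y"
    using inj im by (metis f_the_inv_into_f order_refl the_inv_into_into)
  have g: "bij_betw ?g X Y"
    using h by (rule bij_betw_the_inv_into)
  have c: "card Y = card X"
    using h by (rule bij_betw_same_card)
  have "bij_betw (\<lambda>f. restrict (f \<circ> h) Y) (linear_extensions X r) (linear_extensions Y ?s)"
  proof (rule bij_betw_byWitness[where f' = "\<lambda>f. restrict (f \<circ> ?g) X"])
    show "\<forall>f\<in>linear_extensions X r. restrict (restrict (f \<circ> h) Y \<circ> ?g) X = f"
      using hg by (auto simp: linear_extensions_def fun_eq_iff restrict_def extensional_def)
    show "\<forall>f\<in>linear_extensions Y ?s. restrict (restrict (f \<circ> ?g) X \<circ> h) Y = f"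
      using gh im by (auto simp: linear_extensions_def fun_eq_iff restrict_def extensional_def)
    show "(\<lambda>f. restrict (f \<circ> h) Y) ` linear_extensions X r \<subseteq> linear_extensions Y ?s"
    proof clarify
      fix f assume "f \<in> linear_extensions X r"
      then have f: "bij_betw f X {1..card X}" "\<forall>x\<in>X. \<forall>y\<in>X. r x y \<longrightarrow> f x < f y"
        by (auto simp: linear_extensions_def)
      have "bij_betw (f \<circ> h) Y {1..card Y}"
        unfolding c using h f(1) by (rule bij_betw_trans)
      then have "bij_betw (restrict (f \<circ> h) Y) Y {1..card Y}"
        by (subst bij_betw_cong[where g = "f \<circ> h"]) auto
      then show "restrict (f \<circ> h) Y \<in> linear_extensions Y ?s"
        using f(2) im by (auto simp: linear_extensions_def)
    qed
    show "(\<lambda>f. restrict (f \<circ> ?g) X) ` linear_extensions Y ?s \<subseteq> linear_extensions X r"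
    proof clarify
      fix f assume "f \<in> linear_extensions Y ?s"
      then have f: "bij_betw f Y {1..card Y}" "\<forall>x\<in>Y. \<forall>y\<in>Y. ?s x y \<longrightarrow> f x < f y"
        by (auto simp: linear_extensions_def)
      have "bij_betw (f \<circ> ?g) X {1..card X}"
        unfolding c[symmetric] using g f(1) by (rule bij_betw_trans)
      then have "bij_betw (restrict (f \<circ> ?g) X) X {1..card X}"
        by (subst bij_betw_cong[where g = "f \<circ> ?g"]) auto
      then show "restrict (f \<circ> ?g) X \<in> linear_extensions X r"
        using f(2) hg by (auto simp: linear_extensions_def)
    qed
  qed
  then have e: "num_linext Y ?s = num_linext X r"
    unfolding num_linext_def by (simp add: bij_betw_same_card)
  have b: "upper_size Y ?s y = upper_size X r (h y)" if "y \<in> Y" for y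
    unfolding upper_size_def
  proof (rule bij_betw_same_card)
    show "bij_betw h {z \<in> Y. z = y \<or> ?s y z} {z \<in> X. z = h y \<or> r (h y) z}"
      using inj im that by (auto simp: bij_betw_def inj_on_def)
  qed
  have "(\<Prod>y\<in>Y. int (upper_size Y ?s y)) = (\<Prod>x\<in>X. int (upper_size X r x))"
    using b by (simp add: prod.reindex_bij_betw[OF h, symmetric])
  then show ?thesis
    unfolding xi_def using e c by simp
qed


section \<open>Encoding posets as binary words\<close>

text \<open>The size in unary, terminated by \<open>0\<close>, followed by the rows of the matrix of the strict order.\<close>

definition poset_code :: "nat \<Rightarrow> (nat \<Rightarrow> nat \<Rightarrow> bool) \<Rightarrow> bool list" where
  "poset_code n r =
     replicate n True @ False # concat (map (\<lambda>i. map (r i) [0..<n]) [0..<n])"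


section \<open>Polynomial time on deterministic multitape Turing machines\<close>

datatype head_move = MoveLeft | Stay | MoveRight

text \<open>
  States and tape symbols are initial segments of the natural numbers, so a machine is a finite
  object once its transition function is restricted to lists of \<open>tm_tapes M\<close> symbols, which is all
  that a run depends on. The transition function maps a state and the list of scanned symbols to a
  new state and, for each tape, the symbol to write and the head movement.
\<close>

record turing_machine =
  tm_tapes :: nat
  tm_states :: nat
  tm_symbols :: nat
  tm_start :: nat
  tm_accept :: nat
  tm_reject :: nat
  tm_trans :: "nat \<Rightarrow> nat list \<Rightarrow> nat \<times> (nat \<times> head_move) list"

text \<open>Every machine has at least the symbols blank, the two bits and a separator.\<close>

definition blank :: nat where "blank = 0"
definition bit_symbol :: "bool \<Rightarrow> nat" where "bit_symbol b = (if b then 2 else 1)"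
definition separator :: nat where "separator = 3"

definition wf_machine :: "turing_machine \<Rightarrow> bool" where
  "wf_machine M \<longleftrightarrow>
     1 \<le> tm_tapes M \<and> 4 \<le> tm_symbols M \<and>
     tm_start M < tm_states M \<and> tm_accept M < tm_states M \<and> tm_reject M < tm_states M \<and>
     tm_accept M \<noteq> tm_reject M \<and>
     (\<forall>q ss. q < tm_states M \<and> length ss = tm_tapes M \<and> set ss \<subseteq> {..<tm_symbols M} \<longrightarrow>
        (case tm_trans M q ss of (q', acts) \<Rightarrow>
           q' < tm_states M \<and> length acts = tm_tapes M \<and>
           (\<forall>(s, d)\<in>set acts. s < tm_symbols M)))"

text \<open>A tape is two-way infinite: its contents and the position of its head.\<close>

type_synonym tape = "(int \<Rightarrow> nat) \<times> int"

type_synonym configuration = "nat \<times> tape list"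

definition scan :: "tape \<Rightarrow> nat" where
  "scan T = fst T (snd T)"

fun move_head :: "head_move \<Rightarrow> int \<Rightarrow> int" where
  "move_head MoveLeft i = i - 1"
| "move_head Stay i = i"
| "move_head MoveRight i = i + 1"

fun act :: "nat \<times> head_move \<Rightarrow> tape \<Rightarrow> tape" where
  "act (s, d) (t, i) = (t(i := s), move_head d i)"

definition tm_step :: "turing_machine \<Rightarrow> configuration \<Rightarrow> configuration" where
  "tm_step M C = (case C of (q, Ts) \<Rightarrow>
     if q = tm_accept M \<or> q = tm_reject M then (q, Ts)
     else (case tm_trans M q (map scan Ts) of (q', acts) \<Rightarrow> (q', map2 act acts Ts)))"

definition input_tape :: "nat list \<Rightarrow> tape" where
  "input_tape w = ((\<lambda>i. if 0 \<le> i \<and> i < int (length w) then w ! nat i else blank), 0)"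

definition initial_config :: "turing_machine \<Rightarrow> nat list \<Rightarrow> configuration" where
  "initial_config M w =
     (tm_start M, input_tape w # replicate (tm_tapes M - 1) (input_tape []))"

definition state_after :: "turing_machine \<Rightarrow> nat list \<Rightarrow> nat \<Rightarrow> nat" where
  "state_after M w t = fst ((tm_step M ^^ t) (initial_config M w))"

definition pair_word :: "bool list \<Rightarrow> bool list \<Rightarrow> nat list" where
  "pair_word x y = map bit_symbol x @ separator # map bit_symbol y"

definition poly_time_decidable :: "(bool list \<Rightarrow> bool list \<Rightarrow> bool) \<Rightarrow> bool" where
  "poly_time_decidable R \<longleftrightarrow>
     (\<exists>M (p :: nat poly). wf_machine M \<and>
        (\<forall>x y. \<exists>t \<le> poly p (length (pair_word x y)).
           state_after M (pair_word x y) t = (if R x y then tm_accept M else tm_reject M)))"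


section \<open>The class \<open>#P\<close>\<close>

text \<open>
  Witnesses have length polynomial in the length of the instance; hence there are only finitely
  many for each instance, and deciding \<open>R x y\<close> for such \<open>y\<close> takes time polynomial in \<open>length x\<close>.
\<close>

definition SharpP :: "(bool list \<Rightarrow> nat) set" where
  "SharpP = {f. \<exists>R (p :: nat poly).
     poly_time_decidable R \<and>
     (\<forall>x y. R x y \<longrightarrow> length y \<le> poly p (length x)) \<and>
     (\<forall>x. f x = card {y. R x y})}"

end

theory Submission
  imports Defs "HOL-Library.Countable_Set"
begin

text \<open>
  Let \<open>A\<close> be a finite poset on natural numbers and, for \<open>y \<in> A\<close>, let \<open>\<mu> y\<close> be the least number
  among the minimal elements of \<open>A\<close> below \<open>y\<close>. Since \<open>e(A)\<close> is the sum of \<open>e(A - x)\<close> over the minimal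
  elements \<open>x\<close>, and every \<open>y\<close> is counted by exactly one pair \<open>(x, y)\<close> with \<open>x = \<mu> y\<close>,
  \<open>\<xi>(A)\<close> is the sum over the minimal \<open>x\<close> of \<open>b(x) \<cdot> \<xi>(A - x)\<close>, plus \<open>(|A| - 1)!\<close> times the number of
  pairs \<open>x \<preceq> y\<close> with \<open>x\<close> minimal and \<open>x \<noteq> \<mu> y\<close>. Unrolled, this recursion has no subtraction: it counts
  pairs of a linear order \<open>L\<close> of the ground set and a choice of \<open>y \<succeq> x\<close> for every \<open>x\<close> in a nonempty
  initial segment of \<open>L\<close>, such that each such \<open>x\<close> is minimal among the elements not before it, and the
  last one is not \<open>\<mu>\<close> of its \<open>y\<close> there. Written as two bit matrices, these witnesses are described by a
  first-order formula about positions of the input word, and for a fixed formula the exhaustive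
  evaluation of its quantifiers takes polynomial time, with head positions serving as the variables.
\<close>

section \<open>Structured programs on multitape machines\<close>

text \<open>#P is not known to be closed under subtraction, so it is not allowed to count all
  objects behind the product and discard \<open>n!\<close> of them afterwards; the inequality itself
  must come from a sum of nonnegative terms. Such a sum exists because a minimal \<open>x\<close>
  lies in no other up-set: deleting it leaves every other \<open>b\<close> unchanged, so each
  minimal \<open>x\<close> contributes \<open>b(x) \<cdot> ((|A| - 1)! + \<xi>(A - x))\<close>. The
  sum of \<open>b(x)\<close> over the minimal \<open>x\<close> counts pairs; one pair for each
  \<open>y\<close> suffices to rebuild \<open>|A|!\<close> from the smaller factorials, and the
  other pairs are the gain. The gain carries the factor \<open>(|A| - 1)!\<close>, realised by
  leaving \<open>L\<close> arbitrary after the last choice: hence \<open>L\<close> is a linear order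
  and not a linear extension. On the machine side, using formulas as the programming language
  confines all running time analysis to five constructors. The formula also checks that the input
  encodes a poset, so the counting function vanishes on all other words.\<close>

datatype prog =
    Ret bool
  | Do "nat list \<Rightarrow> nat \<Rightarrow> nat \<times> head_move" "nat list \<Rightarrow> bool"
  | Bind prog prog prog
  | Loop prog

text \<open>
  The states of the machine for a program are its residual programs, so no numbering of program
  points is needed; the conditions are evaluated on the list of scanned symbols.
\<close>

fun cont :: "prog \<Rightarrow> nat list \<Rightarrow> prog" where
  "cont (Ret b) ss = Ret b"
| "cont (Do g c) ss = Ret (c ss)"
| "cont (Bind p q r) ss =
     (case p of Ret b \<Rightarrow> if b then q else r | _ \<Rightarrow> Bind (cont p ss) q r)"
| "cont (Loop p) ss = Bind p (Loop p) (Ret True)"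

text \<open>The clamp \<open>min 4\<close> keeps written symbols in an alphabet of five for an
  arbitrary \<open>g\<close>, so programs carry no well-formedness condition. Steps that only
  rearrange control write back what they scan.\<close>

fun action :: "prog \<Rightarrow> nat list \<Rightarrow> nat \<Rightarrow> nat \<times> head_move" where
  "action (Do g c) ss i = (min 4 (fst (g ss i)), snd (g ss i))"
| "action (Bind p q r) ss i = action p ss i"
| "action _ ss i = (ss ! i, Stay)"

text \<open>An over-approximation of the reachable control points; what counts is that it is finite
  and closed under \<open>cont\<close>. Unfolding \<open>Loop p\<close> gives a \<open>Bind\<close>
  that falls back to the same \<open>Loop p\<close>, so control points do not pile up.\<close>

fun residuals :: "prog \<Rightarrow> prog set" where
  "residuals (Ret b) = {Ret b}"
| "residuals (Do g c) = {Do g c, Ret True, Ret False}"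
| "residuals (Bind p q r) = (\<lambda>p'. Bind p' q r) ` residuals p \<union> residuals q \<union> residuals r"
| "residuals (Loop p) =
     {Loop p, Ret True} \<union> (\<lambda>p'. Bind p' (Loop p) (Ret True)) ` residuals p"

lemma finite_residuals: "finite (residuals p)"
  by (induction p) auto

lemma self_residual: "p \<in> residuals p"
  by (induction p) auto

lemma cont_residual: "p' \<in> residuals p \<Longrightarrow> cont p' ss \<in> residuals p"
proof (induction p arbitrary: p')
  case (Bind p q r)
  show ?case
  proof (cases "p' \<in> (\<lambda>p'. Bind p' q r) ` residuals p")
    case True
    then obtain s where "p' = Bind s q r" "s \<in> residuals p" by auto
    then show ?thesis using Bind.IH(1)[of s] self_residual[of q] self_residual[of r]
      by (cases s) auto
  next
    case False
    then show ?thesis using Bind by auto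
  qed
next
  case (Loop p)
  show ?case
  proof (cases "p' \<in> (\<lambda>p'. Bind p' (Loop p) (Ret True)) ` residuals p")
    case True
    then obtain s where "p' = Bind s (Loop p) (Ret True)" "s \<in> residuals p" by auto
    then show ?thesis using Loop.IH(1)[of s]
      by (cases s) auto
  next
    case False
    then show ?thesis using Loop.prems self_residual[of p] by auto
  qed
qed auto

definition step :: "prog \<times> tape list \<Rightarrow> prog \<times> tape list" where
  "step C = (case C of (p, Ts) \<Rightarrow>
     if p = Ret True \<or> p = Ret False then (p, Ts)
     else (cont p (map scan Ts), map2 act (map (action p (map scan Ts)) [0..<length Ts]) Ts))"

text \<open>Both answers are added because a machine needs distinct accepting and rejecting states
  even if its program can give only one answer.\<close>

definition states :: "prog \<Rightarrow> prog set" where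
  "states p = residuals p \<union> {Ret True, Ret False}"

definition machine :: "nat \<Rightarrow> prog \<Rightarrow> turing_machine" where
  "machine K p = \<lparr>tm_tapes = K, tm_states = card (states p), tm_symbols = 5,
     tm_start = to_nat_on (states p) p,
     tm_accept = to_nat_on (states p) (Ret True),
     tm_reject = to_nat_on (states p) (Ret False),
     tm_trans = (\<lambda>q ss. let p' = from_nat_into (states p) q in
       (to_nat_on (states p) (cont p' ss), map (action p' ss) [0..<length ss]))\<rparr>"

lemma finite_states: "finite (states p)"
  by (simp add: states_def finite_residuals)

lemma cont_states: "p' \<in> states p \<Longrightarrow> cont p' ss \<in> states p"
  by (auto simp: states_def cont_residual)

lemma to_nat_on_states: "p' \<in> states p \<Longrightarrow> to_nat_on (states p) p' < card (states p)"
  using to_nat_on_finite[OF finite_states, of p] by (auto simp: bij_betw_def)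

lemma to_nat_on_states_eq:
  "p' \<in> states p \<Longrightarrow> p'' \<in> states p \<Longrightarrow>
    to_nat_on (states p) p' = to_nat_on (states p) p'' \<longleftrightarrow> p' = p''"
  by (simp add: countable_finite finite_states)

lemma from_nat_into_to_nat_on_states:
  "p' \<in> states p \<Longrightarrow> from_nat_into (states p) (to_nat_on (states p) p') = p'"
  by (simp add: countable_finite finite_states)

lemma action_symbol: "set ss \<subseteq> {..<5} \<Longrightarrow> i < length ss \<Longrightarrow> fst (action p ss i) < 5"
proof (induction p)
  case (Do g c)
  then show ?case by (simp add: min_def)
qed (auto simp: subset_iff)

lemma wf_machine_machine:
  assumes "1 \<le> K"
  shows "wf_machine (machine K p)"
proof -
  let ?S = "states p"
  have mem: "p \<in> ?S" "Ret True \<in> ?S" "Ret False \<in> ?S"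
    by (auto simp: states_def self_residual)
  have into: "from_nat_into ?S q \<in> ?S" for q
    using mem by (intro from_nat_into) auto
  show ?thesis
    unfolding wf_machine_def
  proof (intro conjI allI impI)
    fix q ss
    assume q: "q < tm_states (machine K p) \<and> length ss = tm_tapes (machine K p) \<and>
      set ss \<subseteq> {..<tm_symbols (machine K p)}"
    let ?p = "from_nat_into ?S q"
    have "fst (action ?p ss i) < 5" if "i < K" for i
      using that q by (intro action_symbol) (auto simp: machine_def)
    then have "\<forall>a\<in>set (map (action ?p ss) [0..<length ss]). fst a < 5"
      using q by (auto simp: machine_def)
    then show "case tm_trans (machine K p) q ss of (q', acts) \<Rightarrow>
        q' < tm_states (machine K p) \<and> length acts = tm_tapes (machine K p) \<and>
        (\<forall>(s, d)\<in>set acts. s < tm_symbols (machine K p))"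
      using q to_nat_on_states[OF cont_states[OF into]] by (auto simp: machine_def Let_def)
  qed (use assms mem in \<open>auto simp: machine_def to_nat_on_states to_nat_on_states_eq\<close>)
qed

lemma tm_step_machine:
  assumes "p' \<in> states p"
  shows "tm_step (machine K p) (to_nat_on (states p) p', Ts) =
    (to_nat_on (states p) (fst (step (p', Ts))), snd (step (p', Ts)))"
proof -
  have "Ret True \<in> states p" "Ret False \<in> states p" by (auto simp: states_def)
  then show ?thesis
    using assms
    by (simp add: tm_step_def step_def machine_def to_nat_on_states_eq
        from_nat_into_to_nat_on_states Let_def)
qed

lemma step_states: "fst C \<in> states p \<Longrightarrow> fst (step C) \<in> states p"
  by (auto simp: step_def cont_states split: prod.splits)

lemma funpow_tm_step_machine:
  "(tm_step (machine K p) ^^ t) (to_nat_on (states p) p, Ts) =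
    (to_nat_on (states p) (fst ((step ^^ t) (p, Ts))), snd ((step ^^ t) (p, Ts)))
   \<and> fst ((step ^^ t) (p, Ts)) \<in> states p"
proof (induction t)
  case 0
  then show ?case by (simp add: states_def self_residual)
next
  case (Suc t)
  let ?C = "(step ^^ t) (p, Ts)"
  have mem: "fst ?C \<in> states p" using Suc by simp
  show ?case
    using Suc tm_step_machine[OF mem, of K "snd ?C"] step_states[OF mem] by simp
qed

section \<open>Reachability within a time bound and its composition rules\<close>

definition reach :: "prog \<Rightarrow> tape list \<Rightarrow> nat \<Rightarrow> bool \<Rightarrow> tape list \<Rightarrow> bool" where
  "reach p Ts T b Ts' \<longleftrightarrow> (\<exists>t\<le>T. (step ^^ t) (p, Ts) = (Ret b, Ts'))"

lemma reach_mono: "reach p Ts T b Ts' \<Longrightarrow> T \<le> T' \<Longrightarrow> reach p Ts T' b Ts'"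
  unfolding reach_def using order_trans by blast

lemma reach_Ret: "reach (Ret b) Ts T b Ts"
  unfolding reach_def by (intro exI[of _ 0]) simp

lemma reach_step:
  assumes "reach p' Ts' T b Ts''" "step (p, Ts) = (p', Ts')"
  shows "reach p Ts (Suc T) b Ts''"
proof -
  obtain t where "t \<le> T" "(step ^^ t) (p', Ts') = (Ret b, Ts'')"
    using assms(1) by (auto simp: reach_def)
  then show ?thesis
    unfolding reach_def using assms(2)
    by (intro exI[of _ "Suc t"]) (simp add: funpow_Suc_right del: funpow.simps)
qed

lemma act_stay: "act (fst T (snd T), Stay) T = T"
  by (cases T) simp

lemma map2_act_stay: "map2 act (map (\<lambda>i. (map scan Ts ! i, Stay)) [0..<length Ts]) Ts = Ts"
  by (rule nth_equalityI) (auto simp: scan_def act_stay)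

lemma step_Bind_Ret: "step (Bind (Ret b) q r, Ts) = (if b then q else r, Ts)"
  using map2_act_stay[of Ts] by (simp add: step_def cong: map_cong)

lemma step_Loop: "step (Loop p, Ts) = (Bind p (Loop p) (Ret True), Ts)"
  using map2_act_stay[of Ts] by (simp add: step_def cong: map_cong)

lemma step_Bind:
  assumes "p \<noteq> Ret True" "p \<noteq> Ret False"
  shows "step (Bind p q r, Ts) = (Bind (fst (step (p, Ts))) q r, snd (step (p, Ts)))"
proof (cases p)
  case (Ret b)
  then show ?thesis using assms by (cases b) auto
qed (auto simp: step_def cong: map_cong)

text \<open>A halted program idles under \<open>step\<close>, so \<open>t\<close> may include idle
  steps of \<open>p\<close> that the \<open>Bind\<close> does not perform. The combined run can then
  be shorter, which is why the conclusion is a bound and not an exact step count.\<close>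

lemma reach_Bind_aux:
  "(step ^^ t) (p, Ts) = (Ret b, Ts') \<Longrightarrow> reach (if b then q else r) Ts' T c Ts'' \<Longrightarrow>
    reach (Bind p q r) Ts (Suc (t + T)) c Ts''"
proof (induction t arbitrary: p Ts)
  case 0
  then show ?case using reach_step[OF 0(2), of "Bind p q r" Ts] step_Bind_Ret by simp
next
  case (Suc t)
  show ?case
  proof (cases "p = Ret True \<or> p = Ret False")
    case True
    then have s: "step (p, Ts) = (p, Ts)" by (auto simp: step_def)
    then have "(step ^^ t) (p, Ts) = (Ret b, Ts')"
      using Suc.prems(1) by (simp add: funpow_Suc_right del: funpow.simps)
    from Suc.IH[OF this Suc.prems(2)] show ?thesis
      by (rule reach_mono) simp
  next
    case False
    obtain p' Ts1 where s: "step (p, Ts) = (p', Ts1)" by fastforce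
    then have "(step ^^ t) (p', Ts1) = (Ret b, Ts')"
      using Suc.prems(1) by (simp add: funpow_Suc_right del: funpow.simps)
    from Suc.IH[OF this Suc.prems(2)] have "reach (Bind p' q r) Ts1 (Suc (t + T)) c Ts''" .
    then show ?thesis
      using reach_step[of "Bind p' q r" Ts1 "Suc (t + T)" c Ts'' "Bind p q r" Ts]
        step_Bind[of p q r Ts] False s by simp
  qed
qed

lemma reach_Bind:
  assumes "reach p Ts T1 b Ts'" "reach (if b then q else r) Ts' T2 c Ts''"
  shows "reach (Bind p q r) Ts (T1 + T2 + 1) c Ts''"
proof -
  obtain t where "t \<le> T1" "(step ^^ t) (p, Ts) = (Ret b, Ts')"
    using assms(1) by (auto simp: reach_def)
  from reach_Bind_aux[OF this(2) assms(2)] show ?thesis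
    by (rule reach_mono) (use \<open>t \<le> T1\<close> in simp)
qed

lemma reach_Bind_True:
  "reach p Ts T1 True Ts' \<Longrightarrow> reach q Ts' T2 c Ts'' \<Longrightarrow>
    reach (Bind p q r) Ts (T1 + T2 + 1) c Ts''"
  by (rule reach_Bind) auto

lemma reach_Bind_False:
  "reach p Ts T1 False Ts' \<Longrightarrow> reach r Ts' T2 c Ts'' \<Longrightarrow>
    reach (Bind p q r) Ts (T1 + T2 + 1) c Ts''"
  by (rule reach_Bind) auto

abbreviation Seq :: "prog \<Rightarrow> prog \<Rightarrow> prog" where
  "Seq p q \<equiv> Bind p q q"

lemma reach_Seq:
  assumes "reach p Ts T1 b Ts'" "reach q Ts' T2 c Ts''"
  shows "reach (Seq p q) Ts (T1 + T2 + 1) c Ts''"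
  using reach_Bind[of p Ts T1 b Ts' q q] assms by simp

lemma reach_if_Seq_Ret:
  assumes "reach p Ts T c Ts'"
  shows "reach (if b then Seq p (Ret True) else Seq p (Ret False)) Ts (T + 1) b Ts'"
  using reach_Seq[OF assms reach_Ret[where T = 0]] by (cases b) auto

text \<open>\<open>S\<close> plays the part of an invariant: \<open>S k\<close> is the tape list
  after \<open>k\<close> successful passes. Each of the \<open>m + 1\<close> passes costs
  \<open>T\<close>, one step to unfold the loop and one to leave the \<open>Bind\<close>.\<close>

lemma reach_Loop:
  assumes "\<And>k. k < m \<Longrightarrow> reach p (S k) T True (S (Suc k))"
    and "reach p (S m) T False Ts'"
  shows "reach (Loop p) (S 0) ((m + 1) * (T + 2)) True Ts'"
proof -
  have "j \<le> m \<Longrightarrow> reach (Loop p) (S (m - j)) ((j + 1) * (T + 2)) True Ts'" for j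
  proof (induction j)
    case 0
    have "reach (Bind p (Loop p) (Ret True)) (S m) (T + 0 + 1) True Ts'"
      using assms(2) by (rule reach_Bind) (simp add: reach_Ret)
    from reach_step[OF this step_Loop] show ?case by simp
  next
    case (Suc j)
    then have eq: "Suc (m - Suc j) = m - j" by simp
    have "reach p (S (m - Suc j)) T True (S (m - j))"
      using assms(1)[of "m - Suc j"] Suc.prems unfolding eq by simp
    moreover have "reach (Loop p) (S (m - j)) ((j + 1) * (T + 2)) True Ts'"
      using Suc by simp
    ultimately have "reach (Bind p (Loop p) (Ret True)) (S (m - Suc j))
        (T + (j + 1) * (T + 2) + 1) True Ts'"
      by (intro reach_Bind[where b = True]) auto
    from reach_step[OF this step_Loop] show ?case by (simp add: algebra_simps)
  qed
  from this[of m] show ?thesis by simp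
qed

section \<open>Head positions as counters\<close>

text \<open>Contents and head positions are separated because, once the tapes are prepared, a
  compiled formula only moves heads.\<close>

definition tapes :: "nat \<Rightarrow> (nat \<Rightarrow> int \<Rightarrow> nat) \<Rightarrow> (nat \<Rightarrow> int) \<Rightarrow> tape list" where
  "tapes K C P = map (\<lambda>i. (C i, P i)) [0..<K]"

lemma tapes_cong:
  "(\<And>i. i < K \<Longrightarrow> C i = C' i) \<Longrightarrow> (\<And>i. i < K \<Longrightarrow> P i = P' i) \<Longrightarrow> tapes K C P = tapes K C' P'"
  by (simp add: tapes_def)

lemma reach_Do:
  assumes "1 \<le> T" and "b = c (map (\<lambda>i. C i (P i)) [0..<K])"
    and "\<And>i. i < K \<Longrightarrow>
      C' i = (C i)(P i := min 4 (fst (g (map (\<lambda>i. C i (P i)) [0..<K]) i)))"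
    and "\<And>i. i < K \<Longrightarrow> P' i = move_head (snd (g (map (\<lambda>i. C i (P i)) [0..<K]) i)) (P i)"
  shows "reach (Do g c) (tapes K C P) T b (tapes K C' P')"
proof -
  have ss: "map scan (tapes K C P) = map (\<lambda>i. C i (P i)) [0..<K]"
    by (simp add: tapes_def scan_def)
  have len: "length (tapes K C P) = K" by (simp add: tapes_def)
  have "step (Do g c, tapes K C P) = (Ret b, tapes K C' P')"
    unfolding step_def prod.case ss len
    by (simp add: assms(2) map2_map_map) (auto simp: tapes_def assms map2_map_map)
  from reach_step[OF reach_Ret this, of 0] show ?thesis
    by (rule reach_mono) (use assms(1) in simp)
qed

definition Move :: "(nat \<Rightarrow> head_move) \<Rightarrow> prog" where
  "Move m = Do (\<lambda>ss i. (ss ! i, m i)) (\<lambda>_. True)"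

definition Test :: "nat \<Rightarrow> (nat \<Rightarrow> bool) \<Rightarrow> prog" where
  "Test h Q = Do (\<lambda>ss i. (ss ! i, Stay)) (\<lambda>ss. Q (ss ! h))"

abbreviation Move1 :: "nat \<Rightarrow> head_move \<Rightarrow> prog" where
  "Move1 h d \<equiv> Move ((\<lambda>_. Stay)(h := d))"

text \<open>With symbols at most 4 the clamp in \<open>action\<close> is the identity, so writing
  back the scanned symbol really preserves the contents.\<close>

locale fixed_contents =
  fixes K :: nat and C :: "nat \<Rightarrow> int \<Rightarrow> nat"
  assumes small: "C i x \<le> 4"
begin

lemma reach_Move:
  assumes "1 \<le> T" "\<And>i. i < K \<Longrightarrow> P' i = move_head (m i) (P i)"
  shows "reach (Move m) (tapes K C P) T True (tapes K C P')"
  unfolding Move_def using assms small by (intro reach_Do) (auto simp: min_absorb2)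

lemma reach_Test:
  assumes "1 \<le> T" "h < K" "b = Q (C h (P h))"
  shows "reach (Test h Q) (tapes K C P) T b (tapes K C P)"
  unfolding Test_def using assms small by (intro reach_Do) (auto simp: min_absorb2)

end

text \<open>
  Runs \<open>p\<close> as often as the position of head \<open>i\<close> says: head \<open>i\<close> walks to the left end of its ruler,
  the scratch head \<open>s\<close> remembers the number of steps and afterwards restores head \<open>i\<close>.
\<close>

definition Repeat :: "nat \<Rightarrow> nat \<Rightarrow> prog \<Rightarrow> prog" where
  "Repeat i s p =
     Seq (Loop (Seq (Move1 i MoveLeft)
            (Bind (Test i (\<lambda>a. a = 0)) (Ret False) (Seq p (Move1 s MoveRight)))))
       (Seq (Loop (Seq (Move ((\<lambda>_. Stay)(i := MoveRight, s := MoveLeft))) (Test s (\<lambda>a. a \<noteq> 0))))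
          (Move1 s MoveRight))"

text \<open>Value \<open>0\<close> is the first cell of the ruler, value \<open>n\<close> the blank
  just past it. Having counted down to the end is therefore visible only at position
  \<open>-1\<close>, and loops that count down move before they test.\<close>

definition ruler :: "nat \<Rightarrow> int \<Rightarrow> nat" where
  "ruler n x = (if 0 \<le> x \<and> x < int n then 2 else 0)"

context fixed_contents
begin

text \<open>The hypothesis on \<open>p\<close> ranges over all positions of \<open>h\<close>,
  \<open>i\<close> and \<open>s\<close> because these heads change between the runs. In the bound, a
  pass of the first loop costs \<open>T + 8\<close>, a pass of the second \<open>5\<close>, and the
  \<open>3\<close> remaining steps are absorbed by the factor \<open>n + 1\<close>.\<close>

lemma reach_Repeat:
  assumes ruler: "C i = ruler n" "C s = ruler n"
    and lt: "i < K" "s < K"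
    and neq: "i \<noteq> s" "h \<noteq> i" "h \<noteq> s"
    and start: "P i = int v" "v \<le> n" "P s = 0"
    and body: "\<And>a u w. reach p (tapes K C (P(h := a, i := u, s := w))) T True
                  (tapes K C (P(h := a + \<delta>, i := u, s := w)))"
  shows "reach (Repeat i s p) (tapes K C P) ((n + 1) * (T + 16)) True
           (tapes K C (P(h := P h + int v * \<delta>)))"
proof -
  define S where "S k = tapes K C (P(h := P h + int k * \<delta>, i := int v - int k, s := int k))"
    for k :: nat
  let ?body1 = "Seq (Move1 i MoveLeft)
            (Bind (Test i (\<lambda>a. a = 0)) (Ret False) (Seq p (Move1 s MoveRight)))"
  \<comment> \<open>Head \<open>i\<close> needs \<open>v + 1\<close> moves to leave the ruler, but
    \<open>p\<close> and the scratch head are advanced only \<open>v\<close> times.\<close>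
  let ?end1 = "tapes K C (P(h := P h + int v * \<delta>, i := -1, s := int v))"
  have "reach (Loop ?body1) (S 0) ((v + 1) * ((T + 6) + 2)) True ?end1"
  proof (rule reach_Loop)
    fix k assume k: "k < v"
    let ?P1 = "P(h := P h + int k * \<delta>, i := int v - int k - 1, s := int k)"
    let ?P2 = "P(h := P h + int k * \<delta> + \<delta>, i := int v - int k - 1, s := int k)"
    have 1: "reach (Move1 i MoveLeft) (S k) 1 True (tapes K C ?P1)"
      unfolding S_def by (rule reach_Move) (use neq in auto)
    have 2: "reach (Test i (\<lambda>a. a = 0)) (tapes K C ?P1) 1 False (tapes K C ?P1)"
      by (rule reach_Test) (use neq lt k ruler start(2) in \<open>auto simp: ruler_def\<close>)
    have 3: "reach p (tapes K C ?P1) T True (tapes K C ?P2)"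
      by (rule body)
    have 4: "reach (Move1 s MoveRight) (tapes K C ?P2) 1 True (S (Suc k))"
      unfolding S_def by (rule reach_Move) (use neq in \<open>auto simp: algebra_simps\<close>)
    have "reach ?body1 (S k) (1 + (1 + (T + 1 + 1) + 1) + 1) True (S (Suc k))"
      by (rule reach_Seq[OF 1], rule reach_Bind_False[OF 2], rule reach_Seq[OF 3 4])
    then show "reach ?body1 (S k) (T + 6) True (S (Suc k))"
      by (rule reach_mono) simp
  next
    have 1: "reach (Move1 i MoveLeft) (S v) 1 True ?end1"
      unfolding S_def by (rule reach_Move) (use neq in auto)
    have 2: "reach (Test i (\<lambda>a. a = 0)) ?end1 1 True ?end1"
      by (rule reach_Test) (use neq lt ruler in \<open>auto simp: ruler_def\<close>)
    have "reach ?body1 (S v) (1 + (1 + 0 + 1) + 1) False ?end1"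
      by (rule reach_Seq[OF 1], rule reach_Bind_True[OF 2], rule reach_Ret)
    then show "reach ?body1 (S v) (T + 6) False ?end1"
      by (rule reach_mono) simp
  qed
  then have loop1: "reach (Loop ?body1) (tapes K C P) ((n + 1) * (T + 8)) True ?end1"
  proof -
    assume r: "reach (Loop ?body1) (S 0) ((v + 1) * ((T + 6) + 2)) True ?end1"
    have "S 0 = tapes K C P" unfolding S_def by (rule tapes_cong) (use start in auto)
    moreover have "(v + 1) * ((T + 6) + 2) \<le> (n + 1) * (T + 8)"
      using start(2) by (intro mult_mono) auto
    ultimately show ?thesis using reach_mono[OF r] by simp
  qed
  define R where "R k = tapes K C (P(h := P h + int v * \<delta>, i := int k - 1, s := int v - int k))"
    for k :: nat
  let ?body2 = "Seq (Move ((\<lambda>_. Stay)(i := MoveRight, s := MoveLeft))) (Test s (\<lambda>a. a \<noteq> 0))"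
  \<comment> \<open>Coming from \<open>-1\<close>, head \<open>i\<close> is back at \<open>v\<close>
    exactly when the scratch head has dropped to \<open>-1\<close>, which ends the loop and leaves
    one corrective move.\<close>
  let ?end2 = "tapes K C (P(h := P h + int v * \<delta>, s := -1))"
  have "reach (Loop ?body2) (R 0) ((v + 1) * (3 + 2)) True ?end2"
  proof (rule reach_Loop)
    fix k assume k: "k < v"
    have 1: "reach (Move ((\<lambda>_. Stay)(i := MoveRight, s := MoveLeft))) (R k) 1 True (R (Suc k))"
      unfolding R_def by (rule reach_Move) (use neq in auto)
    have 2: "reach (Test s (\<lambda>a. a \<noteq> 0)) (R (Suc k)) 1 True (R (Suc k))"
      unfolding R_def by (rule reach_Test) (use neq lt k ruler start in \<open>auto simp: ruler_def\<close>)
    show "reach ?body2 (R k) 3 True (R (Suc k))"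
      by (rule reach_mono[OF reach_Seq[OF 1 2]]) simp
  next
    have 1: "reach (Move ((\<lambda>_. Stay)(i := MoveRight, s := MoveLeft))) (R v) 1 True ?end2"
      unfolding R_def by (rule reach_Move) (use neq start in auto)
    have 2: "reach (Test s (\<lambda>a. a \<noteq> 0)) ?end2 1 False ?end2"
      by (rule reach_Test) (use neq lt ruler in \<open>auto simp: ruler_def\<close>)
    show "reach ?body2 (R v) 3 False ?end2"
      by (rule reach_mono[OF reach_Seq[OF 1 2]]) simp
  qed
  then have loop2: "reach (Loop ?body2) ?end1 ((n + 1) * 5) True ?end2"
  proof -
    assume r: "reach (Loop ?body2) (R 0) ((v + 1) * (3 + 2)) True ?end2"
    have "R 0 = ?end1" unfolding R_def by simp
    moreover have "(v + 1) * (3 + 2) \<le> (n + 1) * 5"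
      using start(2) by (intro mult_mono) auto
    ultimately show ?thesis using reach_mono[OF r] by simp
  qed
  have last: "reach (Move1 s MoveRight) ?end2 1 True (tapes K C (P(h := P h + int v * \<delta>)))"
    by (rule reach_Move) (use neq start in auto)
  have "reach (Repeat i s p) (tapes K C P) ((n + 1) * (T + 8) + ((n + 1) * 5 + 1 + 1) + 1) True
      (tapes K C (P(h := P h + int v * \<delta>)))"
    unfolding Repeat_def by (rule reach_Seq[OF loop1], rule reach_Seq[OF loop2 last])
  then show ?thesis by (rule reach_mono) (simp add: algebra_simps)
qed

end

section \<open>First-order formulas about words and their compilation\<close>

text \<open>
  Variables are de Bruijn levels: a quantifier at depth \<open>d\<close> binds variable \<open>d\<close> and ranges over the
  numbers below \<open>n\<close>, the length of the initial block of the symbol \<open>2\<close>. Variables \<open>0\<close> and \<open>1\<close> have the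
  constant value \<open>n\<close>; two copies are needed because a ruler that is being walked along cannot be
  used by an inner loop, as in \<open>n * n\<close>. On the machine, tape \<open>0\<close> holds the input with the
  marker \<open>4\<close> at position \<open>-1\<close>, tapes \<open>1\<close> and \<open>2\<close> are scratch, and the head of tape \<open>3 + i\<close> stands at
  the value of variable \<open>i\<close>; all tapes but tape \<open>0\<close> hold a ruler of length \<open>n\<close>.
\<close>

datatype offset = Unit | Var nat | Times nat

datatype fm =
    Cell "offset list" nat
  | Leq nat nat
  | Neg fm
  | Conj fm fm
  | Forall fm

fun offset_val :: "(nat \<Rightarrow> nat) \<Rightarrow> offset \<Rightarrow> nat" where
  "offset_val \<rho> Unit = 1"
| "offset_val \<rho> (Var i) = \<rho> i"
| "offset_val \<rho> (Times i) = \<rho> i * \<rho> 0"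

definition cell :: "nat list \<Rightarrow> nat \<Rightarrow> nat" where
  "cell w k = (if k < length w then w ! k else 0)"

fun sat :: "nat list \<Rightarrow> nat \<Rightarrow> fm \<Rightarrow> (nat \<Rightarrow> nat) \<Rightarrow> bool" where
  "sat w d (Cell os a) \<rho> \<longleftrightarrow> cell w (sum_list (map (offset_val \<rho>) os)) = a"
| "sat w d (Leq i j) \<rho> \<longleftrightarrow> \<rho> i \<le> \<rho> j"
| "sat w d (Neg \<phi>) \<rho> \<longleftrightarrow> \<not> sat w d \<phi> \<rho>"
| "sat w d (Conj \<phi> \<psi>) \<rho> \<longleftrightarrow> sat w d \<phi> \<rho> \<and> sat w d \<psi> \<rho>"
| "sat w d (Forall \<phi>) \<rho> \<longleftrightarrow> (\<forall>a<\<rho> 0. sat w (Suc d) \<phi> (\<rho>(d := a)))"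

fun offset_ok :: "nat \<Rightarrow> offset \<Rightarrow> bool" where
  "offset_ok d Unit \<longleftrightarrow> True"
| "offset_ok d (Var i) \<longleftrightarrow> i < d"
| "offset_ok d (Times i) \<longleftrightarrow> 0 < i \<and> i < d"

text \<open>\<open>Leq i j\<close> is decided by moving head \<open>3 + j\<close> left by the value
  of \<open>i\<close> and looking whether it is still on the ruler. This takes two different heads
  and a value of \<open>j\<close> below \<open>n\<close>, which excludes the constants
  \<open>0\<close> and \<open>1\<close>. \<open>D\<close> bounds the depth because there are
  \<open>3 + D\<close> tapes.\<close>

fun fm_ok :: "nat \<Rightarrow> nat \<Rightarrow> fm \<Rightarrow> bool" where
  "fm_ok D d (Cell os a) \<longleftrightarrow> list_all (offset_ok d) os"
| "fm_ok D d (Leq i j) \<longleftrightarrow> i \<noteq> j \<and> i < d \<and> 2 \<le> j \<and> j < d"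
| "fm_ok D d (Neg \<phi>) \<longleftrightarrow> fm_ok D d \<phi>"
| "fm_ok D d (Conj \<phi> \<psi>) \<longleftrightarrow> fm_ok D d \<phi> \<and> fm_ok D d \<psi>"
| "fm_ok D d (Forall \<phi>) \<longleftrightarrow> d < D \<and> fm_ok D (Suc d) \<phi>"

text \<open>Nested repetitions need separate scratch heads: tape \<open>2\<close> for the outer one,
  tape \<open>1\<close> for the inner one.\<close>

fun advance :: "offset \<Rightarrow> prog" where
  "advance Unit = Move1 0 MoveRight"
| "advance (Var i) = Repeat (3 + i) 1 (Move1 0 MoveRight)"
| "advance (Times i) = Repeat (3 + i) 2 (Repeat 3 1 (Move1 0 MoveRight))"

text \<open>The head may stand on any input symbol or on a blank past the end, so only the marker
  \<open>4\<close> identifies the left end.\<close>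

definition rewind :: prog where
  "rewind = Seq (Loop (Bind (Test 0 (\<lambda>a. a = 4)) (Ret False) (Move1 0 MoveLeft)))
     (Move1 0 MoveRight)"

definition home :: "nat \<Rightarrow> prog" where
  "home h = Seq (Loop (Seq (Move1 h MoveLeft) (Test h (\<lambda>a. a \<noteq> 0)))) (Move1 h MoveRight)"

text \<open>Clean-up code is duplicated in both branches so that the answer survives in the control
  state. The loop for \<open>Forall\<close> stops at the first counterexample or just past the
  ruler; reading head \<open>3 + d\<close> afterwards tells these apart, since a counterexample lies
  on the ruler.\<close>

fun compile :: "nat \<Rightarrow> fm \<Rightarrow> prog" where
  "compile d (Cell os a) =
     Seq (foldr (\<lambda>t p. Seq (advance t) p) os (Ret True))
       (Bind (Test 0 (\<lambda>b. b = a)) (Seq rewind (Ret True)) (Seq rewind (Ret False)))"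
| "compile d (Leq i j) =
     Seq (Repeat (3 + i) 1 (Move1 (3 + j) MoveLeft))
       (Bind (Test (3 + j) (\<lambda>a. a \<noteq> 0))
         (Seq (Repeat (3 + i) 1 (Move1 (3 + j) MoveRight)) (Ret True))
         (Seq (Repeat (3 + i) 1 (Move1 (3 + j) MoveRight)) (Ret False)))"
| "compile d (Neg \<phi>) = Bind (compile d \<phi>) (Ret False) (Ret True)"
| "compile d (Conj \<phi> \<psi>) = Bind (compile d \<phi>) (compile d \<psi>) (Ret False)"
| "compile d (Forall \<phi>) =
     Seq (Loop (Bind (Test (3 + d) (\<lambda>a. a \<noteq> 0))
            (Bind (compile (Suc d) \<phi>) (Move1 (3 + d) MoveRight) (Ret False)) (Ret False)))
       (Bind (Test (3 + d) (\<lambda>a. a = 0))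
         (Seq (home (3 + d)) (Ret True)) (Seq (home (3 + d)) (Ret False)))"

section \<open>Polynomially bounded running times\<close>

definition poly_bounded :: "(nat \<Rightarrow> nat) \<Rightarrow> bool" where
  "poly_bounded T \<longleftrightarrow> (\<exists>q::nat poly. \<forall>N. T N \<le> poly q N)"

lemma poly_bounded_const: "poly_bounded (\<lambda>_. c)"
  unfolding poly_bounded_def by (rule exI[of _ "[:c:]"]) simp

lemma poly_bounded_id: "poly_bounded (\<lambda>N. N)"
  unfolding poly_bounded_def by (rule exI[of _ "[:0, 1:]"]) simp

lemma poly_bounded_add:
  assumes "poly_bounded S" "poly_bounded T"
  shows "poly_bounded (\<lambda>N. S N + T N)"
proof -
  obtain p q :: "nat poly" where "\<And>N. S N \<le> poly p N" "\<And>N. T N \<le> poly q N"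
    using assms by (auto simp: poly_bounded_def)
  then have "\<forall>N. S N + T N \<le> poly (p + q) N" by (simp add: add_mono)
  then show ?thesis unfolding poly_bounded_def by blast
qed

lemma poly_bounded_mult:
  assumes "poly_bounded S" "poly_bounded T"
  shows "poly_bounded (\<lambda>N. S N * T N)"
proof -
  obtain p q :: "nat poly" where "\<And>N. S N \<le> poly p N" "\<And>N. T N \<le> poly q N"
    using assms by (auto simp: poly_bounded_def)
  then have "\<forall>N. S N * T N \<le> poly (p * q) N" by (simp add: mult_mono)
  then show ?thesis unfolding poly_bounded_def by blast
qed

lemmas poly_bounded_intros =
  poly_bounded_const poly_bounded_id poly_bounded_add poly_bounded_mult

section \<open>Tape layout for a valuation\<close>

definition unary_prefix :: "nat list \<Rightarrow> nat" where
  "unary_prefix w = length (takeWhile (\<lambda>a. a = 2) w)"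

definition contents :: "nat list \<Rightarrow> nat \<Rightarrow> int \<Rightarrow> nat" where
  "contents w t x = (if t = 0 then (if x = -1 then 4 else if x < 0 then 0 else cell w (nat x))
     else ruler (unary_prefix w) x)"

definition heads :: "(nat \<Rightarrow> nat) \<Rightarrow> nat \<Rightarrow> int" where
  "heads \<rho> t = (if t < 3 then 0 else int (\<rho> (t - 3)))"

text \<open>Unbound variables have value \<open>0\<close>: their heads wait at the start of the
  ruler, where a quantifier begins counting.\<close>

definition valuation :: "nat list \<Rightarrow> nat \<Rightarrow> (nat \<Rightarrow> nat) \<Rightarrow> bool" where
  "valuation w d \<rho> \<longleftrightarrow> 2 \<le> d \<and> \<rho> 0 = unary_prefix w \<and> \<rho> 1 = unary_prefix w \<and>
     (\<forall>i. 2 \<le> i \<and> i < d \<longrightarrow> \<rho> i < unary_prefix w) \<and> (\<forall>i\<ge>d. \<rho> i = 0)"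

lemma unary_prefix_le: "unary_prefix w \<le> length w"
  by (simp add: unary_prefix_def length_takeWhile_le)

lemma valuation_le: "valuation w d \<rho> \<Longrightarrow> \<rho> i \<le> unary_prefix w"
  unfolding valuation_def
  by (metis One_nat_def less_2_cases_iff less_imp_le not_less order_refl zero_le)

text \<open>Input symbols below 4 cannot be confused with the marker. The five tapes are the input,
  two scratch tapes and the two constants.\<close>

locale input_word =
  fixes K :: nat and w :: "nat list"
  assumes word: "set w \<subseteq> {..<4}" and K: "5 \<le> K"
begin

lemma cell_less: "cell w k < 4"
  using word by (auto simp: cell_def subset_iff)

sublocale fixed_contents K "contents w"
  by standard
    (auto simp: contents_def ruler_def intro: less_imp_le[OF cell_less])

lemma reach_rewind:
  assumes "P 0 = int a"
  shows "reach rewind (tapes K (contents w) P) ((a + 2) * 7) True (tapes K (contents w) (P(0 := 0)))"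
proof -
  define S where "S k = tapes K (contents w) (P(0 := int a - int k))" for k :: nat
  let ?body = "Bind (Test 0 (\<lambda>a. a = 4)) (Ret False) (Move1 0 MoveLeft)"
  have "reach (Loop ?body) (S 0) ((a + 1 + 1) * (3 + 2)) True (S (a + 1))"
  proof (rule reach_Loop)
    fix k assume k: "k < a + 1"
    have 1: "reach (Test 0 (\<lambda>a. a = 4)) (S k) 1 False (S k)"
      unfolding S_def by (rule reach_Test) (use assms k K cell_less[of "nat (int a - int k)"] in \<open>auto simp: contents_def\<close>)
    have 2: "reach (Move1 0 MoveLeft) (S k) 1 True (S (Suc k))"
      unfolding S_def by (rule reach_Move) auto
    show "reach ?body (S k) 3 True (S (Suc k))"
      by (rule reach_mono[OF reach_Bind_False[OF 1 2]]) simp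
  next
    have 1: "reach (Test 0 (\<lambda>a. a = 4)) (S (a + 1)) 1 True (S (a + 1))"
      unfolding S_def by (rule reach_Test) (use assms K in \<open>auto simp: contents_def\<close>)
    show "reach ?body (S (a + 1)) 3 False (S (a + 1))"
      by (rule reach_mono[OF reach_Bind_True[OF 1 reach_Ret[where T = 1]]]) simp
  qed
  moreover have "S 0 = tapes K (contents w) P"
    unfolding S_def by (rule tapes_cong) (use assms in auto)
  ultimately have 1: "reach (Loop ?body) (tapes K (contents w) P) ((a + 2) * 5) True (S (a + 1))"
    by simp
  have 2: "reach (Move1 0 MoveRight) (S (a + 1)) 1 True (tapes K (contents w) (P(0 := 0)))"
    unfolding S_def by (rule reach_Move) auto
  show ?thesis
    unfolding rewind_def by (rule reach_mono[OF reach_Seq[OF 1 2]]) simp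
qed


lemma reach_home:
  assumes "P h = int v" "v \<le> unary_prefix w" "0 < h" "h < K"
  shows "reach (home h) (tapes K (contents w) P) ((unary_prefix w + 1) * 7) True
    (tapes K (contents w) (P(h := 0)))"
proof -
  define S where "S k = tapes K (contents w) (P(h := int v - int k))" for k :: nat
  let ?body = "Seq (Move1 h MoveLeft) (Test h (\<lambda>a. a \<noteq> 0))"
  have "reach (Loop ?body) (S 0) ((v + 1) * (3 + 2)) True (S (v + 1))"
  proof (rule reach_Loop)
    fix k assume k: "k < v"
    have 1: "reach (Move1 h MoveLeft) (S k) 1 True (S (Suc k))"
      unfolding S_def by (rule reach_Move) auto
    have 2: "reach (Test h (\<lambda>a. a \<noteq> 0)) (S (Suc k)) 1 True (S (Suc k))"
      unfolding S_def
      by (rule reach_Test) (use assms k in \<open>auto simp: contents_def ruler_def\<close>)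
    show "reach ?body (S k) 3 True (S (Suc k))"
      by (rule reach_mono[OF reach_Seq[OF 1 2]]) simp
  next
    have 1: "reach (Move1 h MoveLeft) (S v) 1 True (S (v + 1))"
      unfolding S_def by (rule reach_Move) auto
    have 2: "reach (Test h (\<lambda>a. a \<noteq> 0)) (S (v + 1)) 1 False (S (v + 1))"
      unfolding S_def by (rule reach_Test) (use assms in \<open>auto simp: contents_def ruler_def\<close>)
    show "reach ?body (S v) 3 False (S (v + 1))"
      by (rule reach_mono[OF reach_Seq[OF 1 2]]) simp
  qed
  moreover have "S 0 = tapes K (contents w) P"
    unfolding S_def by (rule tapes_cong) (use assms in auto)
  ultimately have 1: "reach (Loop ?body) (tapes K (contents w) P) ((v + 1) * 5) True (S (v + 1))"
    by simp
  have 2: "reach (Move1 h MoveRight) (S (v + 1)) 1 True (tapes K (contents w) (P(h := 0)))"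
    unfolding S_def by (rule reach_Move) auto
  show ?thesis
    unfolding home_def by (rule reach_mono[OF reach_Seq[OF 1 2]]) (use assms(2) in simp)
qed

text \<open>The common bound is that of \<open>Times\<close>: an inner walk costs at most 17 times
  \<open>unary_prefix w + 1\<close> and is the body of an outer walk.\<close>

lemma reach_advance:
  assumes "valuation w d \<rho>" "3 + d \<le> K" "offset_ok d t"
  shows "reach (advance t) (tapes K (contents w) ((heads \<rho>)(0 := int a)))
    ((unary_prefix w + 1) * ((unary_prefix w + 1) * 17 + 16)) True
    (tapes K (contents w) ((heads \<rho>)(0 := int (a + offset_val \<rho> t))))"
proof (cases t)
  case Unit
  then show ?thesis by (auto intro!: reach_Move)
next
  case (Var i)
  let ?P = "(heads \<rho>)(0 := int a)"
  have "reach (Repeat (3 + i) 1 (Move1 0 MoveRight)) (tapes K (contents w) ?P)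
      ((unary_prefix w + 1) * (1 + 16)) True
      (tapes K (contents w) (?P(0 := ?P 0 + int (\<rho> i) * 1)))"
    by (rule reach_Repeat; (rule reach_Move)?)
      (use assms Var K valuation_le[OF assms(1), of i] in
        \<open>auto simp: contents_def fun_eq_iff heads_def\<close>)
  then have "reach (advance t) (tapes K (contents w) ?P) ((unary_prefix w + 1) * (1 + 16)) True
    (tapes K (contents w) ((heads \<rho>)(0 := int (a + offset_val \<rho> t))))"
    using Var by simp
  then show ?thesis by (rule reach_mono) (intro mult_le_mono; simp)
next
  case (Times i)
  let ?P = "(heads \<rho>)(0 := int a)" and ?n = "unary_prefix w"
  have i: "0 < i" "i < d" using assms Times by auto
  \<comment> \<open>The outer \<open>Repeat\<close> needs its body for all positions of its own
    heads \<open>3 + i\<close> and \<open>2\<close>; by \<open>0 < i\<close> these differ from the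
    heads \<open>3\<close> and \<open>1\<close> of the inner walk.\<close>
  have "reach (Repeat 3 1 (Move1 0 MoveRight))
      (tapes K (contents w) (?P(0 := b, 3 + i := u, 2 := v)))
      ((?n + 1) * (1 + 16)) True
      (tapes K (contents w) (?P(0 := b + int ?n, 3 + i := u, 2 := v)))" for b u v
  proof -
    let ?Q = "?P(0 := b, 3 + i := u, 2 := v)"
    have "reach (Repeat 3 1 (Move1 0 MoveRight)) (tapes K (contents w) ?Q)
        ((?n + 1) * (1 + 16)) True
        (tapes K (contents w) (?Q(0 := ?Q 0 + int ?n * 1)))"
      by (rule reach_Repeat; (rule reach_Move)?)
        (use assms(1) i K in \<open>auto simp: contents_def fun_eq_iff heads_def valuation_def\<close>)
    moreover have "?Q(0 := ?Q 0 + int ?n * 1) = ?P(0 := b + int ?n, 3 + i := u, 2 := v)"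
      using i by (auto simp: fun_eq_iff)
    ultimately show ?thesis by simp
  qed
  then have "reach (Repeat (3 + i) 2 (Repeat 3 1 (Move1 0 MoveRight))) (tapes K (contents w) ?P)
      ((?n + 1) * ((?n + 1) * (1 + 16) + 16)) True
      (tapes K (contents w) (?P(0 := ?P 0 + int (\<rho> i) * int ?n)))"
    by (intro reach_Repeat)
      (use assms i K valuation_le[OF assms(1), of i] in
        \<open>auto simp: contents_def fun_eq_iff heads_def\<close>)
  then show ?thesis using Times assms(1) by (simp add: valuation_def)
qed

end

lemma (in input_word) reach_advances:
  assumes "valuation w d \<rho>" "3 + d \<le> K" "list_all (offset_ok d) os"
  shows "reach (foldr (\<lambda>t p. Seq (advance t) p) os (Ret True))
    (tapes K (contents w) ((heads \<rho>)(0 := int a)))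
    (length os * ((unary_prefix w + 1) * ((unary_prefix w + 1) * 17 + 16) + 1)) True
    (tapes K (contents w) ((heads \<rho>)(0 := int (a + sum_list (map (offset_val \<rho>) os)))))"
  using assms(3)
proof (induction os arbitrary: a)
  case Nil
  then show ?case by (simp add: reach_Ret)
next
  case (Cons t os)
  have t: "offset_ok d t" and os: "list_all (offset_ok d) os" using Cons.prems by auto
  have 1: "reach (foldr (\<lambda>t p. Seq (advance t) p) os (Ret True))
    (tapes K (contents w) ((heads \<rho>)(0 := int (a + offset_val \<rho> t))))
    (length os * ((unary_prefix w + 1) * ((unary_prefix w + 1) * 17 + 16) + 1)) True
    (tapes K (contents w) ((heads \<rho>)(0 := int (a + sum_list (map (offset_val \<rho>) (t # os))))))"
    using Cons.IH[OF os, of "a + offset_val \<rho> t"]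
    by (simp only: list.map sum_list.Cons add.assoc)
  show ?case
    unfolding foldr.simps comp_def
    by (rule reach_mono[OF reach_Seq[OF reach_advance[OF assms(1,2) t] 1]])
      (simp add: algebra_simps)
qed

lemma offset_val_le:
  assumes "valuation w d \<rho>"
  shows "offset_val \<rho> t \<le> (unary_prefix w + 1) * (unary_prefix w + 1)"
proof -
  have "\<rho> i * \<rho> 0 \<le> unary_prefix w * unary_prefix w" for i
    using valuation_le[OF assms] by (intro mult_le_mono) auto
  then show ?thesis
    using valuation_le[OF assms] by (cases t) (auto intro: le_SucI trans_le_add1 trans_le_add2)
qed

lemma sum_list_offset_val_le:
  assumes "valuation w d \<rho>"
  shows "sum_list (map (offset_val \<rho>) os)
    \<le> length os * ((unary_prefix w + 1) * (unary_prefix w + 1))"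
proof (induction os)
  case (Cons t os)
  then show ?case
    using offset_val_le[OF assms, of t] unfolding sum_list.Cons list.map(2) length_Cons mult_Suc
    by linarith
qed simp

text \<open>\<open>T\<close> is chosen before the word and the valuation, so it depends on the
  formula alone; a quantifier multiplies it by about \<open>N + 1\<close>. That all tapes come back
  unchanged is what lets subformulas be run one after another.\<close>

lemma reach_compile:
  assumes "fm_ok D d \<phi>"
  shows "\<exists>T. poly_bounded T \<and> (\<forall>w \<rho>. input_word (3 + D) w \<longrightarrow> valuation w d \<rho> \<longrightarrow> d \<le> D \<longrightarrow>
    reach (compile d \<phi>) (tapes (3 + D) (contents w) (heads \<rho>)) (T (length w)) (sat w d \<phi> \<rho>)
      (tapes (3 + D) (contents w) (heads \<rho>)))"
  using assms
proof (induction \<phi> arbitrary: d)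
  case (Cell os a)
  define T where "T N = length os * ((N + 1) * ((N + 1) * 17 + 16) + 1)
    + (length os * ((N + 1) * (N + 1)) + 2) * 7 + 6" for N
  have "poly_bounded T"
    unfolding T_def by (intro poly_bounded_intros)
  moreover have "reach (compile d (Cell os a)) (tapes (3 + D) (contents w) (heads \<rho>))
      (T (length w)) (sat w d (Cell os a) \<rho>) (tapes (3 + D) (contents w) (heads \<rho>))"
    if w: "input_word (3 + D) w" and \<rho>: "valuation w d \<rho>" and d: "d \<le> D" for w \<rho>
  proof -
    interpret input_word "3 + D" w by fact
    let ?v = "sum_list (map (offset_val \<rho>) os)" and ?n = "unary_prefix w"
    let ?b = "sat w d (Cell os a) \<rho>"
    let ?P = "(heads \<rho>)(0 := int ?v)"
    have start: "(heads \<rho>)(0 := int 0) = heads \<rho>" and home: "?P(0 := 0) = heads \<rho>"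
      by (auto simp: heads_def)
    have 1: "reach (foldr (\<lambda>t p. Seq (advance t) p) os (Ret True))
      (tapes (3 + D) (contents w) (heads \<rho>))
      (length os * ((?n + 1) * ((?n + 1) * 17 + 16) + 1)) True (tapes (3 + D) (contents w) ?P)"
      using reach_advances[OF \<rho>, of os 0] d Cell unfolding start fm_ok.simps add_0 by simp
    have 2: "reach (Test 0 (\<lambda>b. b = a)) (tapes (3 + D) (contents w) ?P) 1 ?b
      (tapes (3 + D) (contents w) ?P)"
      by (rule reach_Test) (auto simp: contents_def)
    have 3: "reach rewind (tapes (3 + D) (contents w) ?P) ((?v + 2) * 7) True
      (tapes (3 + D) (contents w) (heads \<rho>))"
      using reach_rewind[of ?P ?v] unfolding home by simp
    have 4: "reach (if ?b then Seq rewind (Ret True) else Seq rewind (Ret False))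
      (tapes (3 + D) (contents w) ?P) ((?v + 2) * 7 + 1) ?b
      (tapes (3 + D) (contents w) (heads \<rho>))"
      by (rule reach_if_Seq_Ret[OF 3])
    have "length os * ((?n + 1) * ((?n + 1) * 17 + 16) + 1)
      \<le> length os * ((length w + 1) * ((length w + 1) * 17 + 16) + 1)"
      using unary_prefix_le[of w] by (intro mult_le_mono add_le_mono) auto
    moreover have "(?v + 2) * 7 \<le> (length os * ((length w + 1) * (length w + 1)) + 2) * 7"
      by (intro mult_le_mono add_le_mono order_trans[OF sum_list_offset_val_le[OF \<rho>]])
        (use unary_prefix_le[of w] in auto)
    ultimately show ?thesis
      unfolding compile.simps T_def
      by (intro reach_mono[OF reach_Seq[OF 1 reach_Bind[OF 2 4]]]) linarith
  qed
  ultimately show ?case by blast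
next
  case (Leq i j)
  define T where "T N = (N + 1) * 17 + (N + 1) * 17 + 6" for N :: nat
  have "poly_bounded T"
    unfolding T_def by (intro poly_bounded_intros)
  moreover have "reach (compile d (Leq i j)) (tapes (3 + D) (contents w) (heads \<rho>))
      (T (length w)) (sat w d (Leq i j) \<rho>) (tapes (3 + D) (contents w) (heads \<rho>))"
    if w: "input_word (3 + D) w" and \<rho>: "valuation w d \<rho>" and d: "d \<le> D" for w \<rho>
  proof -
    interpret input_word "3 + D" w by fact
    let ?n = "unary_prefix w" and ?b = "sat w d (Leq i j) \<rho>"
    let ?P = "(heads \<rho>)(3 + j := int (\<rho> j) - int (\<rho> i))"
    have j: "\<rho> j < ?n" and ij: "i \<noteq> j" "i < d" "j < d" using \<rho> Leq by (auto simp: valuation_def)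
    have home: "?P(3 + j := ?P (3 + j) + int (\<rho> i) * 1) = heads \<rho>"
      by (auto simp: heads_def)
    have away: "(heads \<rho>)(3 + j := heads \<rho> (3 + j) + int (\<rho> i) * (- 1)) = ?P"
      by (auto simp: heads_def)
    have "reach (Repeat (3 + i) 1 (Move1 (3 + j) MoveLeft))
      (tapes (3 + D) (contents w) (heads \<rho>)) ((?n + 1) * (1 + 16)) True
      (tapes (3 + D) (contents w) ((heads \<rho>)(3 + j := heads \<rho> (3 + j) + int (\<rho> i) * (- 1))))"
      by (rule reach_Repeat; (rule reach_Move)?)
        (use ij d valuation_le[OF \<rho>, of i] in \<open>auto simp: contents_def fun_eq_iff heads_def\<close>)
    then have 1: "reach (Repeat (3 + i) 1 (Move1 (3 + j) MoveLeft))
      (tapes (3 + D) (contents w) (heads \<rho>)) ((?n + 1) * (1 + 16)) True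
      (tapes (3 + D) (contents w) ?P)"
      unfolding away .
    have 2: "reach (Test (3 + j) (\<lambda>a. a \<noteq> 0)) (tapes (3 + D) (contents w) ?P) 1 ?b
      (tapes (3 + D) (contents w) ?P)"
      by (rule reach_Test) (use ij j d in \<open>auto simp: contents_def ruler_def\<close>)
    have "reach (Repeat (3 + i) 1 (Move1 (3 + j) MoveRight))
      (tapes (3 + D) (contents w) ?P) ((?n + 1) * (1 + 16)) True
      (tapes (3 + D) (contents w) (?P(3 + j := ?P (3 + j) + int (\<rho> i) * 1)))"
      by (rule reach_Repeat; (rule reach_Move)?)
        (use ij d valuation_le[OF \<rho>, of i] in \<open>auto simp: contents_def fun_eq_iff heads_def\<close>)
    then have 3: "reach (Repeat (3 + i) 1 (Move1 (3 + j) MoveRight))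
      (tapes (3 + D) (contents w) ?P) ((?n + 1) * (1 + 16)) True
      (tapes (3 + D) (contents w) (heads \<rho>))"
      unfolding home .
    have 4: "reach (if ?b then Seq (Repeat (3 + i) 1 (Move1 (3 + j) MoveRight)) (Ret True)
        else Seq (Repeat (3 + i) 1 (Move1 (3 + j) MoveRight)) (Ret False))
      (tapes (3 + D) (contents w) ?P) ((?n + 1) * (1 + 16) + 1) ?b
      (tapes (3 + D) (contents w) (heads \<rho>))"
      by (rule reach_if_Seq_Ret[OF 3])
    show ?thesis
      unfolding compile.simps T_def
      by (intro reach_mono[OF reach_Seq[OF 1 reach_Bind[OF 2 4]]])
        (use unary_prefix_le[of w] in simp)
  qed
  ultimately show ?case by blast
next
  case (Neg \<phi>)
  then obtain T where T: "poly_bounded T"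
    "\<And>w \<rho>. input_word (3 + D) w \<Longrightarrow> valuation w d \<rho> \<Longrightarrow> d \<le> D \<Longrightarrow>
      reach (compile d \<phi>) (tapes (3 + D) (contents w) (heads \<rho>)) (T (length w)) (sat w d \<phi> \<rho>)
        (tapes (3 + D) (contents w) (heads \<rho>))"
    by (metis fm_ok.simps(3))
  have "reach (compile d (Neg \<phi>)) (tapes (3 + D) (contents w) (heads \<rho>)) (T (length w) + 1)
      (sat w d (Neg \<phi>) \<rho>) (tapes (3 + D) (contents w) (heads \<rho>))"
    if "input_word (3 + D) w" "valuation w d \<rho>" "d \<le> D" for w \<rho>
    unfolding compile.simps
    by (rule reach_mono[OF reach_Bind[OF T(2)[OF that], of _ _ 0]]) (auto simp: reach_Ret)
  moreover have "poly_bounded (\<lambda>N. T N + 1)"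
    using T(1) by (intro poly_bounded_intros)
  ultimately show ?case by (intro exI[of _ "\<lambda>N. T N + 1"]) blast
next
  case (Conj \<phi> \<psi>)
  then obtain T where T: "poly_bounded T"
    "\<And>w \<rho>. input_word (3 + D) w \<Longrightarrow> valuation w d \<rho> \<Longrightarrow> d \<le> D \<Longrightarrow>
      reach (compile d \<phi>) (tapes (3 + D) (contents w) (heads \<rho>)) (T (length w)) (sat w d \<phi> \<rho>)
        (tapes (3 + D) (contents w) (heads \<rho>))"
    by (metis fm_ok.simps(4))
  obtain U where U: "poly_bounded U"
    "\<And>w \<rho>. input_word (3 + D) w \<Longrightarrow> valuation w d \<rho> \<Longrightarrow> d \<le> D \<Longrightarrow>
      reach (compile d \<psi>) (tapes (3 + D) (contents w) (heads \<rho>)) (U (length w)) (sat w d \<psi> \<rho>)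
        (tapes (3 + D) (contents w) (heads \<rho>))"
    using Conj by (metis fm_ok.simps(4))
  have "reach (compile d (Conj \<phi> \<psi>)) (tapes (3 + D) (contents w) (heads \<rho>))
      (T (length w) + U (length w) + 1)
      (sat w d (Conj \<phi> \<psi>) \<rho>) (tapes (3 + D) (contents w) (heads \<rho>))"
    if "input_word (3 + D) w" "valuation w d \<rho>" "d \<le> D" for w \<rho>
    unfolding compile.simps
    by (rule reach_Bind[OF T(2)[OF that]]) (use U(2)[OF that] in \<open>auto simp: reach_Ret\<close>)
  moreover have "poly_bounded (\<lambda>N. T N + U N + 1)"
    using T(1) U(1) by (intro poly_bounded_intros)
  ultimately show ?case by (intro exI[of _ "\<lambda>N. T N + U N + 1"]) blast
next
  case (Forall \<phi>)
  then obtain T where T: "poly_bounded T"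
    "\<And>w \<rho>. input_word (3 + D) w \<Longrightarrow> valuation w (Suc d) \<rho> \<Longrightarrow> Suc d \<le> D \<Longrightarrow>
      reach (compile (Suc d) \<phi>) (tapes (3 + D) (contents w) (heads \<rho>)) (T (length w))
        (sat w (Suc d) \<phi> \<rho>) (tapes (3 + D) (contents w) (heads \<rho>))"
    by (metis fm_ok.simps(5))
  define U where "U N = (N + 1) * (T N + 6) + (N + 1) * 7 + 6" for N
  have "poly_bounded U"
    unfolding U_def using T(1) by (intro poly_bounded_intros)
  moreover have "reach (compile d (Forall \<phi>)) (tapes (3 + D) (contents w) (heads \<rho>))
      (U (length w)) (sat w d (Forall \<phi>) \<rho>) (tapes (3 + D) (contents w) (heads \<rho>))"
    if w: "input_word (3 + D) w" and \<rho>: "valuation w d \<rho>" and "d \<le> D" for w \<rho>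
  proof -
    interpret input_word "3 + D" w by fact
    let ?n = "unary_prefix w" and ?b = "sat w d (Forall \<phi>) \<rho>"
    have d: "d < D" using Forall.prems by simp
    have \<rho>0: "\<rho> 0 = ?n" "\<rho> d = 0" "2 \<le> d" using \<rho> by (auto simp: valuation_def)
    define S where "S k = tapes (3 + D) (contents w) ((heads \<rho>)(3 + d := int k))" for k :: nat
    have S: "S k = tapes (3 + D) (contents w) (heads (\<rho>(d := k)))" for k
      unfolding S_def by (rule tapes_cong) (auto simp: heads_def)
    have S0: "S 0 = tapes (3 + D) (contents w) (heads \<rho>)"
      unfolding S using \<rho>0 by (metis fun_upd_triv)
    \<comment> \<open>The first counterexample, or \<open>?n\<close> if there is none: in either
      case the number of successful passes of the loop.\<close>
    define m where "m = (LEAST k. k = ?n \<or> \<not> sat w (Suc d) \<phi> (\<rho>(d := k)))"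
    have m: "m = ?n \<or> \<not> sat w (Suc d) \<phi> (\<rho>(d := m))"
      unfolding m_def by (rule LeastI[of _ ?n]) simp
    have m_le: "m \<le> ?n"
      unfolding m_def by (rule Least_le) simp
    have below: "k < ?n \<and> sat w (Suc d) \<phi> (\<rho>(d := k))" if "k < m" for k
      using not_less_Least[OF that[unfolded m_def]] that m_le by simp
    have b: "?b \<longleftrightarrow> m = ?n"
      using m m_le below \<rho>0 by (auto simp: le_less)
    let ?body = "Bind (Test (3 + d) (\<lambda>a. a \<noteq> 0))
      (Bind (compile (Suc d) \<phi>) (Move1 (3 + d) MoveRight) (Ret False)) (Ret False)"
    have test: "reach (Test (3 + d) (\<lambda>a. a \<noteq> 0)) (S k) 1 (k < ?n) (S k)" for k
      unfolding S_def by (rule reach_Test) (use d in \<open>auto simp: contents_def ruler_def\<close>)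
    have body: "reach (compile (Suc d) \<phi>) (S k) (T (length w)) (sat w (Suc d) \<phi> (\<rho>(d := k))) (S k)"
      if "k < ?n" for k
      unfolding S using \<rho> that d by (intro T(2)[OF w]) (auto simp: valuation_def)
    have "reach (Loop ?body) (S 0) ((m + 1) * ((T (length w) + 4) + 2)) True (S m)"
    proof (rule reach_Loop)
      fix k assume k: "k < m"
      have 1: "reach (Test (3 + d) (\<lambda>a. a \<noteq> 0)) (S k) 1 True (S k)"
        using test[of k] below[OF k] by simp
      have 2: "reach (compile (Suc d) \<phi>) (S k) (T (length w)) True (S k)"
        using body[of k] below[OF k] by simp
      have 3: "reach (Move1 (3 + d) MoveRight) (S k) 1 True (S (Suc k))"
        unfolding S_def by (rule reach_Move) auto
      show "reach ?body (S k) (T (length w) + 4) True (S (Suc k))"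
        by (rule reach_mono[OF reach_Bind_True[OF 1 reach_Bind_True[OF 2 3]]]) simp
    next
      show "reach ?body (S m) (T (length w) + 4) False (S m)"
      proof (cases "m = ?n")
        case True
        then have 1: "reach (Test (3 + d) (\<lambda>a. a \<noteq> 0)) (S m) 1 False (S m)"
          using test[of m] by simp
        show ?thesis
          by (rule reach_mono[OF reach_Bind_False[OF 1 reach_Ret[where T = 0]]]) simp
      next
        case False
        then have 1: "reach (Test (3 + d) (\<lambda>a. a \<noteq> 0)) (S m) 1 True (S m)"
          using test[of m] m_le by simp
        have 2: "reach (compile (Suc d) \<phi>) (S m) (T (length w)) False (S m)"
          using body[of m] m m_le False by simp
        show ?thesis
          by (rule reach_mono[OF reach_Bind_True[OF 1 reach_Bind_False[OF 2 reach_Ret[where T = 0]]]])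
            simp
      qed
    qed
    then have 1: "reach (Loop ?body) (S 0) ((m + 1) * (T (length w) + 6)) True (S m)"
      by (rule reach_mono) simp
    have 2: "reach (Test (3 + d) (\<lambda>a. a = 0)) (S m) 1 ?b (S m)"
      unfolding S_def b
      by (rule reach_Test) (use d m_le in \<open>auto simp: contents_def ruler_def\<close>)
    have 3: "reach (home (3 + d)) (S m) ((?n + 1) * 7) True (S 0)"
    proof -
      have "reach (home (3 + d)) (S m) ((?n + 1) * 7) True
          (tapes (3 + D) (contents w) ((heads \<rho>)(3 + d := int m, 3 + d := 0)))"
        unfolding S_def by (rule reach_home[of _ _ m]) (use d m_le in auto)
      then show ?thesis by (simp add: S_def)
    qed
    have 4: "reach (if ?b then Seq (home (3 + d)) (Ret True) else Seq (home (3 + d)) (Ret False))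
      (S m) ((?n + 1) * 7 + 1) ?b (S 0)"
      by (rule reach_if_Seq_Ret[OF 3])
    have "(m + 1) * (T (length w) + 6) \<le> (length w + 1) * (T (length w) + 6)"
      using m_le unary_prefix_le[of w] by (intro mult_le_mono) auto
    moreover have "a + (1 + ((?n + 1) * 7 + 1) + 1) + 1 \<le> b + (length w + 1) * 7 + 6"
      if "a \<le> b" for a b
      using that unary_prefix_le[of w] by simp
    ultimately have "(m + 1) * (T (length w) + 6) + (1 + ((?n + 1) * 7 + 1) + 1) + 1 \<le> U (length w)"
      unfolding U_def by blast
    then show ?thesis
      unfolding compile.simps S0[symmetric]
      by (rule reach_mono[OF reach_Seq[OF 1 reach_Bind[OF 2 4]]])
  qed
  ultimately show ?case by blast
qed

section \<open>Preparing the marker, the rulers and the constants\<close>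

definition mark :: prog where
  "mark = Seq (Move1 0 MoveLeft)
     (Do (\<lambda>ss i. if i = 0 then (4, MoveRight) else (ss ! i, Stay)) (\<lambda>_. True))"

text \<open>All tapes write \<open>2\<close> in lockstep with the input head, so every ruler gets
  the length of the unary block; on tape \<open>0\<close> this rewrites the symbol already
  there.\<close>

definition copy_prefix :: prog where
  "copy_prefix = Loop (Do (\<lambda>ss i. if ss ! 0 = 2 then (2, MoveRight) else (ss ! i, Stay))
     (\<lambda>ss. ss ! 0 = 2))"

text \<open>Heads \<open>3\<close> and \<open>4\<close> stay at \<open>n\<close>, which makes
  variables \<open>0\<close> and \<open>1\<close> the constant \<open>n\<close>. The others walk
  back until the input head meets the marker, one cell too far, and the final move corrects
  this.\<close>

definition retract :: prog where
  "retract = Seq (Loop (Do (\<lambda>ss i. (ss ! i, if ss ! 0 \<noteq> 4 \<and> i \<notin> {3, 4} then MoveLeft else Stay))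
       (\<lambda>ss. ss ! 0 \<noteq> 4)))
     (Move (\<lambda>i. if i \<in> {3, 4} then Stay else MoveRight))"

definition start_val :: "nat list \<Rightarrow> nat \<Rightarrow> nat" where
  "start_val w i = (if i < 2 then unary_prefix w else 0)"

lemma nth_unary_prefix: "k < unary_prefix w \<Longrightarrow> cell w k = 2"
  unfolding unary_prefix_def cell_def
  by (metis (mono_tags) length_takeWhile_le nth_mem order_less_le_trans set_takeWhileD takeWhile_nth)

lemma cell_unary_prefix: "cell w (unary_prefix w) \<noteq> 2"
  unfolding unary_prefix_def cell_def
  using nth_length_takeWhile[of "\<lambda>a. a = 2" w] by auto

lemma valuation_start: "valuation w 2 (start_val w)"
  by (simp add: valuation_def start_val_def)

context input_word
begin

definition partial_contents :: "nat \<Rightarrow> nat \<Rightarrow> int \<Rightarrow> nat" where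
  "partial_contents k t = (if t = 0 then contents w 0 else ruler k)"

lemma partial_contents_le: "partial_contents k t x \<le> 4"
  using small[of 0 x] by (simp add: partial_contents_def ruler_def)

lemma initial_tapes:
  "input_tape w # replicate (K - 1) (input_tape []) =
    tapes K (\<lambda>t. if t = 0 then fst (input_tape w) else (\<lambda>_. 0)) (\<lambda>_. 0)"
  by (rule nth_equalityI)
    (use K in \<open>auto simp: tapes_def input_tape_def blank_def nth_Cons split: nat.splits\<close>)

lemma reach_mark:
  "reach mark (input_tape w # replicate (K - 1) (input_tape [])) 3 True
    (tapes K (partial_contents 0) (\<lambda>_. 0))"
proof -
  let ?C = "\<lambda>t. if t = 0 then fst (input_tape w) else (\<lambda>_::int. 0::nat)"
  have le: "?C t x \<le> 4" for t x
    using word by (auto simp: input_tape_def blank_def subset_iff less_imp_le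
        intro: less_imp_le[OF less_trans, of _ 4])
  then interpret init: fixed_contents K ?C
    by unfold_locales
  have 1: "reach (Move1 0 MoveLeft) (tapes K ?C (\<lambda>_. 0)) 1 True (tapes K ?C ((\<lambda>_. 0)(0 := -1)))"
    by (rule init.reach_Move) auto
  have 2: "reach (Do (\<lambda>ss i. if i = 0 then (4, MoveRight) else (ss ! i, Stay)) (\<lambda>_. True))
      (tapes K ?C ((\<lambda>_. 0)(0 := -1))) 1 True (tapes K (partial_contents 0) (\<lambda>_. 0))"
    by (rule reach_Do)
      (auto simp: partial_contents_def ruler_def contents_def input_tape_def blank_def
        cell_def fun_eq_iff)
  show ?thesis
    unfolding mark_def initial_tapes by (rule reach_mono[OF reach_Seq[OF 1 2]]) simp
qed

lemma reach_copy_prefix: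
  "reach copy_prefix (tapes K (partial_contents 0) (\<lambda>_. 0)) ((unary_prefix w + 1) * (1 + 2)) True
    (tapes K (contents w) (\<lambda>_. int (unary_prefix w)))"
proof -
  define S where "S k = tapes K (partial_contents k) (\<lambda>_. int k)" for k
  let ?p = "Do (\<lambda>ss i. if ss ! 0 = 2 then (2, MoveRight) else (ss ! i, Stay)) (\<lambda>ss. ss ! 0 = (2::nat))"
  have "reach (Loop ?p) (S 0) ((unary_prefix w + 1) * (1 + 2)) True (S (unary_prefix w))"
  proof (rule reach_Loop)
    fix k assume k: "k < unary_prefix w"
    then have "cell w k = 2" by (rule nth_unary_prefix)
    then show "reach ?p (S k) 1 True (S (Suc k))"
      unfolding S_def using K
      by (intro reach_Do) (auto simp: partial_contents_def contents_def ruler_def fun_eq_iff)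
  next
    have "cell w (unary_prefix w) \<noteq> 2" by (rule cell_unary_prefix)
    then show "reach ?p (S (unary_prefix w)) 1 False (S (unary_prefix w))"
      unfolding S_def using K partial_contents_le
      by (intro reach_Do) (auto simp: partial_contents_def contents_def min_absorb2)
  qed
  moreover have "S (unary_prefix w) = tapes K (contents w) (\<lambda>_. int (unary_prefix w))"
    unfolding S_def by (rule tapes_cong) (auto simp: partial_contents_def contents_def fun_eq_iff)
  ultimately show ?thesis by (simp add: copy_prefix_def S_def)
qed

lemma reach_retract:
  "reach retract (tapes K (contents w) (\<lambda>_. int (unary_prefix w))) ((unary_prefix w + 3) * 3) True
    (tapes K (contents w) (heads (start_val w)))"
proof -
  let ?n = "unary_prefix w"
  define S where "S k = tapes K (contents w)
    (\<lambda>t. if t \<in> {3, 4} then int ?n else int ?n - int k)" for k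
  let ?p = "Do (\<lambda>ss i. (ss ! i, if ss ! 0 \<noteq> 4 \<and> i \<notin> {3, 4} then MoveLeft else Stay))
       (\<lambda>ss. ss ! 0 \<noteq> (4::nat))"
  have "reach (Loop ?p) (S 0) ((?n + 1 + 1) * (1 + 2)) True (S (?n + 1))"
  proof (rule reach_Loop)
    fix k assume k: "k < ?n + 1"
    then have "contents w 0 (int ?n - int k) \<noteq> 4"
      using cell_less[of "nat (int ?n - int k)"] by (auto simp: contents_def)
    then show "reach ?p (S k) 1 True (S (Suc k))"
      unfolding S_def using K small by (intro reach_Do) (auto simp: min_absorb2)
  next
    have "contents w 0 (int ?n - int (?n + 1)) = 4"
      by (simp add: contents_def)
    then show "reach ?p (S (?n + 1)) 1 False (S (?n + 1))"
      unfolding S_def using K small by (intro reach_Do) (auto simp: min_absorb2)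
  qed
  moreover have "S 0 = tapes K (contents w) (\<lambda>_. int ?n)"
    unfolding S_def by (rule tapes_cong) auto
  ultimately have 1: "reach (Loop ?p) (tapes K (contents w) (\<lambda>_. int ?n)) ((?n + 1 + 1) * (1 + 2)) True (S (?n + 1))"
    by simp
  have 2: "reach (Move (\<lambda>i. if i \<in> {3, 4} then Stay else MoveRight)) (S (?n + 1)) 1 True
      (tapes K (contents w) (heads (start_val w)))"
    unfolding S_def by (rule reach_Move) (auto simp: heads_def start_val_def)
  show ?thesis
    unfolding retract_def by (rule reach_mono[OF reach_Seq[OF 1 2]]) simp
qed

end

lemma pair_word_less: "set (pair_word x y) \<subseteq> {..<4}"
  by (auto simp: pair_word_def separator_def bit_symbol_def)

theorem poly_time_decidable_sat:
  assumes "fm_ok D 2 \<phi>" "2 \<le> D"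
  shows "poly_time_decidable (\<lambda>x y. sat (pair_word x y) 2 \<phi> (start_val (pair_word x y)))"
proof -
  let ?K = "3 + D" and ?p = "Seq mark (Seq copy_prefix (Seq retract (compile 2 \<phi>)))"
  let ?M = "machine ?K ?p"
  obtain T where T: "poly_bounded T"
    "\<And>w. input_word ?K w \<Longrightarrow>
      reach (compile 2 \<phi>) (tapes ?K (contents w) (heads (start_val w))) (T (length w))
        (sat w 2 \<phi> (start_val w)) (tapes ?K (contents w) (heads (start_val w)))"
    using reach_compile[OF assms(1)] assms(2) valuation_start by blast
  define U where "U N = T N + (N + 3) * 6 + 6" for N
  have "poly_bounded U"
    unfolding U_def using T(1) by (intro poly_bounded_intros)
  then obtain q :: "nat poly" where q: "\<And>N. U N \<le> poly q N" by (auto simp: poly_bounded_def)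
  have "\<exists>t \<le> poly q (length (pair_word x y)). state_after ?M (pair_word x y) t =
      (if sat (pair_word x y) 2 \<phi> (start_val (pair_word x y)) then tm_accept ?M else tm_reject ?M)"
    for x y
  proof -
    let ?w = "pair_word x y"
    let ?b = "sat ?w 2 \<phi> (start_val ?w)"
    interpret input_word ?K ?w
      by standard (use pair_word_less assms(2) in auto)
    have "reach ?p (input_tape ?w # replicate (?K - 1) (input_tape [])) (U (length ?w)) ?b
        (tapes ?K (contents ?w) (heads (start_val ?w)))"
      by (rule reach_mono[OF reach_Seq[OF reach_mark reach_Seq[OF reach_copy_prefix
                reach_Seq[OF reach_retract T(2)[OF input_word_axioms]]]]])
        (use unary_prefix_le[of ?w] in \<open>simp add: U_def\<close>)
    then obtain t Ts where t: "t \<le> U (length ?w)"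
      "(step ^^ t) (?p, input_tape ?w # replicate (?K - 1) (input_tape [])) = (Ret ?b, Ts)"
      by (auto simp: reach_def)
    have "state_after ?M ?w t = to_nat_on (states ?p) (Ret ?b)"
      unfolding state_after_def initial_config_def
      using funpow_tm_step_machine[of t ?K ?p "input_tape ?w # replicate (?K - 1) (input_tape [])"] t(2)
      by (simp add: machine_def)
    moreover have "t \<le> poly q (length ?w)" using t(1) q order_trans by blast
    ultimately show ?thesis by (intro exI[of _ t]) (auto simp: machine_def)
  qed
  moreover have "wf_machine ?M" by (rule wf_machine_machine) simp
  ultimately show ?thesis unfolding poly_time_decidable_def by blast
qed

section \<open>Linear extensions and minimal elements\<close>

definition minimals :: "'a set \<Rightarrow> ('a \<Rightarrow> 'a \<Rightarrow> bool) \<Rightarrow> 'a set" where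
  "minimals A r = {x \<in> A. \<forall>u\<in>A. \<not> r u x}"

definition upset :: "'a set \<Rightarrow> ('a \<Rightarrow> 'a \<Rightarrow> bool) \<Rightarrow> 'a \<Rightarrow> 'a set" where
  "upset A r x = {y \<in> A. y = x \<or> r x y}"

lemma finite_poset_subset: "finite_poset A r \<Longrightarrow> B \<subseteq> A \<Longrightarrow> finite_poset B r"
  unfolding finite_poset_def
  by (meson finite_subset irreflp_on_subset transp_on_subset)

text \<open>Descend to the elements strictly below \<open>y\<close>: one that is minimal there is
  minimal in all of \<open>A\<close>, since by transitivity anything below it would again be below
  \<open>y\<close>.\<close>

lemma ex_minimal_below:
  assumes "finite_poset A r" "y \<in> A"
  shows "\<exists>z\<in>minimals A r. z = y \<or> r z y"
  using assms
proof (induction "card A" arbitrary: A y rule: less_induct)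
  case less
  let ?B = "{u \<in> A. r u y}"
  show ?case
  proof (cases "?B = {}")
    case True
    then show ?thesis using less.prems by (auto simp: minimals_def)
  next
    case False
    then obtain u where u: "u \<in> ?B" by blast
    have irr: "\<not> r y y" using less.prems by (auto simp: finite_poset_def irreflp_on_def)
    have "?B \<subset> A" using less.prems(2) irr by blast
    moreover have "finite A" using less.prems(1) by (simp add: finite_poset_def)
    ultimately have "card ?B < card A" by (simp only: psubset_card_mono)
    moreover have "finite_poset ?B r"
      using less.prems(1) by (rule finite_poset_subset) blast
    ultimately obtain z where z: "z \<in> minimals ?B r" "z = u \<or> r z u"
      using less.hyps[of ?B u] u by blast
    have tr: "\<And>a b c. a \<in> A \<Longrightarrow> b \<in> A \<Longrightarrow> c \<in> A \<Longrightarrow> r a b \<Longrightarrow> r b c \<Longrightarrow> r a c"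
      using less.prems(1) unfolding finite_poset_def by (blast dest: transp_onD)
    have zB: "z \<in> A" "r z y" "\<And>v. v \<in> A \<Longrightarrow> r v y \<Longrightarrow> \<not> r v z"
      using z(1) by (auto simp: minimals_def)
    have "\<not> r v z" if "v \<in> A" for v
      using zB tr[OF that zB(1) less.prems(2)] that by blast
    then have "z \<in> minimals A r"
      using zB(1) by (simp add: minimals_def)
    then show ?thesis using zB(2) by blast
  qed
qed

lemma bij_betw_shift:
  assumes "finite A" "x \<in> A" "bij_betw f (A - {x}) {1..card (A - {x})}"
  shows "bij_betw (\<lambda>y. if y = x then 1 else Suc (f y)) A {1..card A}"
proof -
  let ?g = "\<lambda>y. if y = x then 1 else Suc (f y)"
  define m where "m = card (A - {x})"
  have c: "card A = Suc m" unfolding m_def using assms(1,2) by (rule card.remove)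
  have f: "bij_betw f (A - {x}) {1..m}" using assms(3) by (simp add: m_def)
  have "bij_betw Suc {1..m} {2..Suc m}"
    by (rule bij_betw_byWitness[where f' = "\<lambda>k. k - 1"]) auto
  with f have "bij_betw (Suc \<circ> f) (A - {x}) {2..Suc m}"
    by (rule bij_betw_trans)
  moreover have "bij_betw ?g (A - {x}) {2..Suc m} = bij_betw (Suc \<circ> f) (A - {x}) {2..Suc m}"
    by (rule bij_betw_cong) simp
  ultimately have "bij_betw ?g (A - {x}) {2..Suc m}"
    by simp
  moreover have "bij_betw ?g {x} {1}"
    by (simp add: bij_betw_def)
  ultimately have "bij_betw ?g ((A - {x}) \<union> {x}) ({2..Suc m} \<union> {1})"
    by (rule bij_betw_combine) simp
  moreover have "(A - {x}) \<union> {x} = A" using assms(2) by blast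
  moreover have "{2..Suc m} \<union> {1} = {1..Suc m}" by auto
  ultimately show ?thesis unfolding c by simp
qed

lemma finite_linear_extensions: "finite A \<Longrightarrow> finite (linear_extensions A r)"
  by (rule finite_subset[of _ "PiE A (\<lambda>_. {1..card A})"])
    (auto simp: linear_extensions_def extensional_def bij_betw_def intro: finite_PiE)

text \<open>A minimal \<open>x\<close> may take position \<open>1\<close>, and the rest is a linear
  extension of \<open>A - {x}\<close> shifted by one. Restricting keeps the functions extensional,
  which makes the correspondence bijective.\<close>

lemma linear_extensions_cons:
  assumes "finite A" "x \<in> minimals A r"
  shows "bij_betw (\<lambda>f. \<lambda>y\<in>A. if y = x then 1 else Suc (f y))
    (linear_extensions (A - {x}) r) {f \<in> linear_extensions A r. f x = 1}"
proof -
  have x: "x \<in> A" "\<And>u. u \<in> A \<Longrightarrow> \<not> r u x" using assms(2) by (auto simp: minimals_def)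
  have c: "card A = Suc (card (A - {x}))" using assms(1) x(1) by (rule card.remove)
  show ?thesis
  proof (rule bij_betw_byWitness[where f' = "\<lambda>f. \<lambda>y\<in>A - {x}. f y - 1"])
    show "\<forall>f\<in>linear_extensions (A - {x}) r.
        (\<lambda>y\<in>A - {x}. (\<lambda>y\<in>A. if y = x then 1 else Suc (f y)) y - 1) = f"
      by (auto simp: linear_extensions_def fun_eq_iff restrict_def extensional_def)
    have ge: "1 \<le> f y" if "f \<in> linear_extensions A r" "y \<in> A" for f y
      using that bij_betw_apply[of f A "{1..card A}" y] by (simp add: linear_extensions_def)
    show "\<forall>f\<in>{f \<in> linear_extensions A r. f x = 1}.
        (\<lambda>y\<in>A. if y = x then 1 else Suc ((\<lambda>y\<in>A - {x}. f y - 1) y)) = f"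
    proof clarify
      fix f assume f: "f \<in> linear_extensions A r" "f x = 1"
      show "(\<lambda>y\<in>A. if y = x then 1 else Suc ((\<lambda>y\<in>A - {x}. f y - 1) y)) = f"
      proof
        fix y show "(\<lambda>y\<in>A. if y = x then 1 else Suc ((\<lambda>y\<in>A - {x}. f y - 1) y)) y = f y"
          using f ge[OF f(1), of y]
          by (cases "y \<in> A") (auto simp: linear_extensions_def extensional_def)
      qed
    qed
    show "(\<lambda>f. \<lambda>y\<in>A. if y = x then 1 else Suc (f y)) ` linear_extensions (A - {x}) r
      \<subseteq> {f \<in> linear_extensions A r. f x = 1}"
    proof clarify
      fix f assume "f \<in> linear_extensions (A - {x}) r"
      then have f: "bij_betw f (A - {x}) {1..card (A - {x})}"
        "\<And>u v. u \<in> A - {x} \<Longrightarrow> v \<in> A - {x} \<Longrightarrow> r u v \<Longrightarrow> f u < f v"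
        by (auto simp: linear_extensions_def)
      have "bij_betw (\<lambda>y\<in>A. if y = x then 1 else Suc (f y)) A {1..card A}"
        using bij_betw_shift[OF assms(1) x(1) f(1)] by (subst bij_betw_cong) auto
      moreover have "1 \<le> f u" if "u \<in> A - {x}" for u
        using bij_betw_apply[OF f(1) that] by simp
      ultimately show "(\<lambda>y\<in>A. if y = x then 1 else Suc (f y)) \<in> linear_extensions A r \<and>
          (\<lambda>y\<in>A. if y = x then 1 else Suc (f y)) x = 1"
        using f(2) x by (simp add: linear_extensions_def Suc_le_eq)
    qed
    show "(\<lambda>f. \<lambda>y\<in>A - {x}. f y - 1) ` {f \<in> linear_extensions A r. f x = 1}
      \<subseteq> linear_extensions (A - {x}) r"
    proof clarify
      fix f assume fA: "f \<in> linear_extensions A r" and fx: "f x = 1"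
      then have f: "bij_betw f A {1..card A}"
        "\<And>u v. u \<in> A \<Longrightarrow> v \<in> A \<Longrightarrow> r u v \<Longrightarrow> f u < f v"
        by (auto simp: linear_extensions_def)
      have "bij_betw f (A - {x}) ({1..card A} - {1})"
        using f(1) fx x(1) by (auto simp: bij_betw_def inj_on_diff inj_on_image_set_diff[of f A A "{x}"])
      also have "{1..card A} - {1} = {2..card A}" by auto
      finally have "bij_betw f (A - {x}) {2..card A}" .
      moreover have "bij_betw (\<lambda>k. k - 1) {2..card A} {1..card (A - {x})}"
        unfolding c by (rule bij_betw_byWitness[where f' = Suc]) auto
      ultimately have "bij_betw ((\<lambda>k. k - 1) \<circ> f) (A - {x}) {1..card (A - {x})}"
        by (rule bij_betw_trans)
      then have "bij_betw (\<lambda>y\<in>A - {x}. f y - 1) (A - {x}) {1..card (A - {x})}"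
        by (subst bij_betw_cong[where g = "(\<lambda>k. k - 1) \<circ> f"]) auto
      then show "(\<lambda>y\<in>A - {x}. f y - 1) \<in> linear_extensions (A - {x}) r"
        using f(2) ge[OF fA] by (simp add: linear_extensions_def diff_less_mono)
    qed
  qed
qed

lemma num_linext_rec:
  assumes "finite A" "A \<noteq> {}"
  shows "num_linext A r = (\<Sum>x\<in>minimals A r. num_linext (A - {x}) r)"
proof -
  let ?E = "\<lambda>x. {f \<in> linear_extensions A r. f x = 1}"
  have inj: "inj_on f A" if "f \<in> linear_extensions A r" for f
    using that by (auto simp: linear_extensions_def bij_betw_def)
  have "linear_extensions A r = (\<Union>x\<in>minimals A r. ?E x)"
  proof (intro equalityI subsetI)
    fix f assume f: "f \<in> linear_extensions A r"
    have "0 < card A" using assms by (simp add: card_gt_0_iff)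
    then have "1 \<in> {1..card A}" by simp
    moreover have "f ` A = {1..card A}"
      using f by (simp add: linear_extensions_def bij_betw_def)
    ultimately obtain x where x: "x \<in> A" "f x = 1"
      by (metis imageE)
    have "\<not> r u x" if u: "u \<in> A" for u
    proof
      assume "r u x"
      then have "f u < f x" "f u \<in> {1..card A}"
        using f x(1) u bij_betw_apply[of f A "{1..card A}" u] by (auto simp: linear_extensions_def)
      then show False using x(2) by simp
    qed
    then show "f \<in> (\<Union>x\<in>minimals A r. ?E x)"
      using f x by (auto simp: minimals_def)
  qed auto
  then have "num_linext A r = card (\<Union>x\<in>minimals A r. ?E x)"
    by (simp add: num_linext_def)
  also have "\<dots> = (\<Sum>x\<in>minimals A r. card (?E x))"
  proof (rule card_UN_disjoint)
    show "\<forall>x\<in>minimals A r. \<forall>y\<in>minimals A r. x \<noteq> y \<longrightarrow> ?E x \<inter> ?E y = {}"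
    proof (intro ballI impI)
      fix x y assume "x \<in> minimals A r" "y \<in> minimals A r" "x \<noteq> y"
      then have "f x \<noteq> f y" if "f \<in> linear_extensions A r" for f
        using inj_onD[OF inj[OF that], of x y] by (auto simp: minimals_def)
      then show "?E x \<inter> ?E y = {}"
        by (intro equals0I) (metis (mono_tags, lifting) IntE mem_Collect_eq)
    qed
    show "finite (minimals A r)" using assms(1) by (simp add: minimals_def)
    show "\<forall>x\<in>minimals A r. finite (?E x)"
      using finite_linear_extensions[OF assms(1), of r] by simp
  qed
  also have "\<dots> = (\<Sum>x\<in>minimals A r. num_linext (A - {x}) r)"
    using bij_betw_same_card[OF linear_extensions_cons[OF assms(1)]]
    by (intro sum.cong) (simp_all add: num_linext_def)
  finally show ?thesis .
qed

section \<open>Witnesses\<close>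

text \<open>Orders are sets of pairs and not position functions because a set of pairs is exactly
  the bit matrix that the formula reads.\<close>

definition linorder_rel :: "'a set \<Rightarrow> ('a \<times> 'a) set \<Rightarrow> bool" where
  "linorder_rel A L \<longleftrightarrow> L \<subseteq> A \<times> A \<and> (\<forall>x\<in>A. (x, x) \<notin> L) \<and>
     (\<forall>x\<in>A. \<forall>y\<in>A. x = y \<or> (x, y) \<in> L \<or> (y, x) \<in> L) \<and>
     (\<forall>x\<in>A. \<forall>y\<in>A. \<forall>z\<in>A. (x, y) \<in> L \<longrightarrow> (y, z) \<in> L \<longrightarrow> (x, z) \<in> L)"

definition cons_rel :: "'a \<Rightarrow> 'a set \<Rightarrow> ('a \<times> 'a) set \<Rightarrow> ('a \<times> 'a) set" where
  "cons_rel x B L = {x} \<times> B \<union> L"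

lemma linorder_relD:
  assumes "linorder_rel A L"
  shows linorder_rel_subset: "L \<subseteq> A \<times> A"
    and linorder_rel_irrefl: "(x, x) \<notin> L"
    and linorder_rel_total: "x \<in> A \<Longrightarrow> y \<in> A \<Longrightarrow> x = y \<or> (x, y) \<in> L \<or> (y, x) \<in> L"
    and linorder_rel_trans: "(x, y) \<in> L \<Longrightarrow> (y, z) \<in> L \<Longrightarrow> (x, z) \<in> L"
proof -
  note d = assms[unfolded linorder_rel_def]
  show sub: "L \<subseteq> A \<times> A" using d[THEN conjunct1] .
  show "(x, x) \<notin> L"
    using d[THEN conjunct2, THEN conjunct1] sub by blast
  show "x = y \<or> (x, y) \<in> L \<or> (y, x) \<in> L" if "x \<in> A" "y \<in> A"
    using d[THEN conjunct2, THEN conjunct2, THEN conjunct1] that by blast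
  show "(x, z) \<in> L" if xyz: "(x, y) \<in> L" "(y, z) \<in> L"
  proof -
    have "x \<in> A" "y \<in> A" "z \<in> A" using xyz sub by blast+
    with d[THEN conjunct2, THEN conjunct2, THEN conjunct2] xyz show ?thesis
      by (metis (no_types, lifting))
  qed
qed

lemma linorder_rel_restrict:
  assumes "linorder_rel A L" "B \<subseteq> A"
  shows "linorder_rel B (L \<inter> B \<times> B)"
  unfolding linorder_rel_def
proof (intro conjI ballI impI)
  show "x = y \<or> (x, y) \<in> L \<inter> B \<times> B \<or> (y, x) \<in> L \<inter> B \<times> B" if "x \<in> B" "y \<in> B" for x y
    using linorder_rel_total[OF assms(1), of x y] assms(2) that by blast
  show "(x, z) \<in> L \<inter> B \<times> B" if "(x, y) \<in> L \<inter> B \<times> B" "(y, z) \<in> L \<inter> B \<times> B" for x y z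
    using linorder_rel_trans[OF assms(1), of x y z] that by blast
qed (use linorder_rel_irrefl[OF assms(1)] in blast)+

lemma linorder_rel_cons:
  assumes "x \<notin> B" "linorder_rel B L"
  shows "linorder_rel (insert x B) (cons_rel x B L)"
proof -
  note sub = linorder_rel_subset[OF assms(2)] and irr = linorder_rel_irrefl[OF assms(2)]
    and tot = linorder_rel_total[OF assms(2)] and tr = linorder_rel_trans[OF assms(2)]
  have mem: "(u, v) \<in> cons_rel x B L \<longleftrightarrow> u = x \<and> v \<in> B \<or> (u, v) \<in> L" for u v
    by (auto simp: cons_rel_def)
  show ?thesis
    unfolding linorder_rel_def mem
  proof (intro conjI ballI impI)
    show "cons_rel x B L \<subseteq> insert x B \<times> insert x B"
      using sub by (auto simp: cons_rel_def)
    show "\<not> (u = x \<and> u \<in> B \<or> (u, u) \<in> L)" for u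
      using assms(1) irr by blast
    show "u = v \<or> (u = x \<and> v \<in> B \<or> (u, v) \<in> L) \<or> v = x \<and> u \<in> B \<or> (v, u) \<in> L"
      if "u \<in> insert x B" "v \<in> insert x B" for u v
      using that tot by blast
    show "u = x \<and> z \<in> B \<or> (u, z) \<in> L"
      if "u = x \<and> v \<in> B \<or> (u, v) \<in> L" "v = x \<and> z \<in> B \<or> (v, z) \<in> L" for u v z
      using that tr[of u v z] sub assms(1) by blast
  qed
qed

lemma linorder_rel_first:
  assumes "finite A" "A \<noteq> {}" "linorder_rel A L"
  shows "\<exists>x\<in>A. \<forall>z\<in>A - {x}. (x, z) \<in> L"
  using assms
proof (induction "card A" arbitrary: A L)
  case 0
  then show ?case by simp
next
  case (Suc m)
  obtain a where a: "a \<in> A" using Suc.prems by blast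
  show ?case
  proof (cases "A - {a} = {}")
    case True
    then show ?thesis using a by blast
  next
    case False
    have "m = card (A - {a})" using Suc.hyps(2) Suc.prems(1) a by simp
    moreover have "linorder_rel (A - {a}) (L \<inter> (A - {a}) \<times> (A - {a}))"
      using Suc.prems(3) by (rule linorder_rel_restrict) blast
    moreover have "finite (A - {a})" using Suc.prems(1) by simp
    ultimately have "\<exists>x\<in>A - {a}. \<forall>z\<in>A - {a} - {x}. (x, z) \<in> L \<inter> (A - {a}) \<times> (A - {a})"
      using False by (intro Suc.hyps(1))
    then obtain x where x: "x \<in> A" "x \<noteq> a"
      "\<And>z. z \<in> A \<Longrightarrow> z \<noteq> a \<Longrightarrow> z \<noteq> x \<Longrightarrow> (x, z) \<in> L" by blast
    show ?thesis
    proof (cases "(x, a) \<in> L")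
      case True
      then have "(x, z) \<in> L" if "z \<in> A - {x}" for z
        using x(3)[of z] that by (cases "z = a") auto
      then show ?thesis using x(1) by blast
    next
      case False
      then have ax: "(a, x) \<in> L"
        using linorder_rel_total[OF Suc.prems(3) x(1) a] x(2) by blast
      have "(a, z) \<in> L" if "z \<in> A - {a}" for z
        using linorder_rel_trans[OF Suc.prems(3) ax x(3)[of z]] ax that by (cases "z = x") auto
      then show ?thesis using a by blast
    qed
  qed
qed

lemma linorder_rel_decomp:
  assumes "finite A" "A \<noteq> {}" "linorder_rel A L"
  obtains x L' where "x \<in> A" "L = cons_rel x (A - {x}) L'" "linorder_rel (A - {x}) L'"
proof -
  obtain x where x: "x \<in> A" "\<forall>z\<in>A - {x}. (x, z) \<in> L"
    using linorder_rel_first[OF assms] by blast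
  let ?L = "L \<inter> (A - {x}) \<times> (A - {x})"
  have "(z, x) \<notin> L" for z
  proof
    assume z: "(z, x) \<in> L"
    then have "z \<in> A - {x}"
      using linorder_rel_subset[OF assms(3)] linorder_rel_irrefl[OF assms(3)] by blast
    then have "(x, z) \<in> L" using x(2) by blast
    from linorder_rel_trans[OF assms(3) this z] show False
      using linorder_rel_irrefl[OF assms(3)] by blast
  qed
  then have "L = cons_rel x (A - {x}) ?L"
    using linorder_rel_subset[OF assms(3)] x(2) unfolding cons_rel_def by fast
  moreover have "linorder_rel (A - {x}) ?L"
    using assms(3) by (rule linorder_rel_restrict) blast
  ultimately show ?thesis using that x(1) by blast
qed

lemma cons_rel_inj:
  assumes "cons_rel x (A - {x}) L = cons_rel x' (A - {x'}) L'" "x \<in> A" "x' \<in> A"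
    "linorder_rel (A - {x}) L" "linorder_rel (A - {x'}) L'"
  shows "x = x' \<and> L = L'"
proof -
  note sub = assms(4)[THEN linorder_rel_subset] assms(5)[THEN linorder_rel_subset]
  have eq: "\<And>p. p \<in> {x} \<times> (A - {x}) \<union> L \<longleftrightarrow> p \<in> {x'} \<times> (A - {x'}) \<union> L'"
    using assms(1) by (simp add: cons_rel_def)
  have x: "x = x'"
  proof (rule ccontr)
    assume "x \<noteq> x'"
    then have "(x, x') \<in> {x} \<times> (A - {x}) \<union> L" using assms(3) by blast
    then have "(x, x') \<in> {x'} \<times> (A - {x'}) \<union> L'" unfolding eq .
    then show False using sub(2) \<open>x \<noteq> x'\<close> by blast
  qed
  have "p \<in> L \<longleftrightarrow> p \<in> L'" for p
    using eq[of p] sub unfolding x by blast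
  then show ?thesis using x by blast
qed

lemma finite_linorder_rel: "finite A \<Longrightarrow> finite {L. linorder_rel A L}"
  by (rule finite_subset[of _ "Pow (A \<times> A)"]) (auto simp: linorder_rel_def)

text \<open>The first element is arbitrary, and any order of the others may follow. For
  \<open>A - {x}\<close> this provides the factor \<open>(|A| - 1)!\<close> of the
  recursion.\<close>

lemma card_linorder_rel:
  assumes "finite A"
  shows "card {L. linorder_rel A L} = fact (card A)"
  using assms
proof (induction "card A" arbitrary: A)
  case 0
  then have A: "A = {}" by simp
  have "{L. linorder_rel A L} = {{}}" unfolding A linorder_rel_def by auto
  then show ?case using A by simp
next
  case (Suc m)
  then have ne: "A \<noteq> {}" by auto
  let ?S = "SIGMA x:A. {L. linorder_rel (A - {x}) L}"
  let ?h = "\<lambda>(x, L). cons_rel x (A - {x}) L"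
  have "?h ` ?S = {L. linorder_rel A L}"
  proof (intro equalityI subsetI)
    fix L assume "L \<in> {L. linorder_rel A L}"
    then have "linorder_rel A L" by simp
    then obtain x L' where x: "x \<in> A" "L = cons_rel x (A - {x}) L'" "linorder_rel (A - {x}) L'"
      by (rule linorder_rel_decomp[OF Suc.prems ne])
    show "L \<in> ?h ` ?S"
      by (rule image_eqI[of _ _ "(x, L')"]) (simp_all add: x)
  next
    fix L assume "L \<in> ?h ` ?S"
    then obtain p where p: "L = ?h p" "p \<in> ?S" by (rule imageE)
    obtain x L' where p': "p = (x, L')" by (rule prod.exhaust)
    have x: "x \<in> A" "linorder_rel (A - {x}) L'" using p(2) by (simp_all add: p')
    have "linorder_rel (insert x (A - {x})) (cons_rel x (A - {x}) L')"
      by (rule linorder_rel_cons) (simp_all add: x)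
    then show "L \<in> {L. linorder_rel A L}"
      using p(1) by (simp only: p' prod.case insert_Diff[OF x(1)] mem_Collect_eq)
  qed
  moreover have "inj_on ?h ?S"
  proof (rule inj_onI, clarify)
    fix x L x' L'
    assume "x \<in> A" "linorder_rel (A - {x}) L" "x' \<in> A" "linorder_rel (A - {x'}) L'"
      "cons_rel x (A - {x}) L = cons_rel x' (A - {x'}) L'"
    then show "x = x' \<and> L = L'"
      by (intro cons_rel_inj)
  qed
  ultimately have "card {L. linorder_rel A L} = card ?S"
    using card_image[of ?h ?S] by simp
  also have "\<dots> = (\<Sum>x\<in>A. card {L. linorder_rel (A - {x}) L})"
    using Suc.prems finite_linorder_rel by (intro card_SigmaI) auto
  also have "\<dots> = (\<Sum>x\<in>A. fact m)"
  proof (rule sum.cong)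
    fix x assume "x \<in> A"
    then have "m = card (A - {x})" using Suc by simp
    then show "card {L. linorder_rel (A - {x}) L} = fact m"
      using Suc.hyps(1)[of "A - {x}"] Suc.prems by simp
  qed simp
  also have "\<dots> = fact (card A)" using Suc.hyps(2) by (simp flip: Suc.hyps(2))
  finally show ?case .
qed

section \<open>Witness pairs and their recursion\<close>

text \<open>For minimal \<open>x \<preceq> y\<close> this says that \<open>x\<close> is not the least minimal element below \<open>y\<close>.\<close>

definition non_least :: "nat set \<Rightarrow> (nat \<Rightarrow> nat \<Rightarrow> bool) \<Rightarrow> nat \<Rightarrow> nat \<Rightarrow> bool" where
  "non_least A r x y \<longleftrightarrow> (\<exists>z\<in>minimals A r. z < x \<and> (z = y \<or> r z y))"

definition chosen :: "('a \<times> 'a) set \<Rightarrow> 'a \<Rightarrow> bool" where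
  "chosen Y x \<longleftrightarrow> (\<exists>y. (x, y) \<in> Y)"

text \<open>\<open>Y\<close> is the graph of a partial choice function. Minimality is demanded only
  on its domain, so \<open>L\<close> is unconstrained afterwards.
  \<open>insert x {z\<in>A. (x, z) \<in> L}\<close> is what is left of the poset when
  \<open>x\<close> is removed. Only the last clause forces \<open>Y\<close> to be nonempty.\<close>

definition witness :: "nat set \<Rightarrow> (nat \<Rightarrow> nat \<Rightarrow> bool) \<Rightarrow> (nat \<times> nat) set \<Rightarrow> (nat \<times> nat) set \<Rightarrow> bool" where
  "witness A r L Y \<longleftrightarrow> linorder_rel A L \<and> Y \<subseteq> A \<times> A \<and>
     (\<forall>x\<in>A. \<forall>y\<in>A. (x, y) \<in> Y \<longrightarrow>
        (y = x \<or> r x y) \<and> (\<forall>z\<in>A. (x, z) \<in> Y \<longrightarrow> z = y) \<and> (\<forall>z\<in>A. (x, z) \<in> L \<longrightarrow> \<not> r z x)) \<and>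
     (\<forall>x\<in>A. \<forall>z\<in>A. (x, z) \<in> L \<longrightarrow> chosen Y z \<longrightarrow> chosen Y x) \<and>
     (\<exists>x\<in>A. \<exists>y\<in>A. (x, y) \<in> Y \<and> (\<forall>z\<in>A. (x, z) \<in> L \<longrightarrow> \<not> chosen Y z) \<and>
        non_least (insert x {z\<in>A. (x, z) \<in> L}) r x y)"

lemma finite_witness: "finite A \<Longrightarrow> finite {(L, Y). witness A r L Y}"
  by (rule finite_subset[of _ "Pow (A \<times> A) \<times> Pow (A \<times> A)"])
    (auto simp: witness_def linorder_rel_def)

text \<open>The clauses speak about an element and those after it in \<open>L\<close>, so for
  elements of \<open>B\<close> they are unaffected by putting \<open>x\<close> in front. Either the
  choices go on in \<open>B\<close> or they end at \<open>x\<close>; these cases exclude each other,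
  since the \<open>Y\<close> of a witness is nonempty.\<close>

lemma witness_cons:
  assumes "x \<notin> B" "\<not> r x x" "Y \<subseteq> B \<times> B" "y \<in> insert x B" "linorder_rel B L"
  shows "witness (insert x B) r (cons_rel x B L) (insert (x, y) Y) \<longleftrightarrow>
    x \<in> minimals (insert x B) r \<and> y \<in> upset (insert x B) r x \<and>
    (witness B r L Y \<or> Y = {} \<and> non_least (insert x B) r x y)"
proof -
  let ?A = "insert x B" and ?L = "cons_rel x B L" and ?Y = "insert (x, y) Y"
  have L_sub: "L \<subseteq> B \<times> B" using assms(5) by (simp add: linorder_rel_def)
  have lin: "linorder_rel ?A ?L"
    using assms(1,5) by (rule linorder_rel_cons)
  have Lx: "(x, z) \<in> ?L \<longleftrightarrow> z \<in> B" for z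
    using L_sub assms(1) by (auto simp: cons_rel_def)
  have Lu: "(u, z) \<in> ?L \<longleftrightarrow> (u, z) \<in> L" if "u \<in> B" for u z
    using that assms(1) by (auto simp: cons_rel_def)
  have Yx: "(x, z) \<in> ?Y \<longleftrightarrow> z = y" for z
    using assms(1,3) by auto
  have Yu: "(u, z) \<in> ?Y \<longleftrightarrow> (u, z) \<in> Y" if "u \<in> B" for u z
    using that assms(1) by auto
  have cx: "chosen ?Y x" by (auto simp: chosen_def)
  have cu: "chosen ?Y u \<longleftrightarrow> chosen Y u" if "u \<in> B" for u
    using Yu[OF that] by (simp add: chosen_def)
  have sets: "{z \<in> ?A. (x, z) \<in> ?L} = B" "\<And>u. u \<in> B \<Longrightarrow> {z \<in> ?A. (u, z) \<in> ?L} = {z \<in> B. (u, z) \<in> L}"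
    using Lx Lu L_sub by auto
  have not_x: "(u, x) \<notin> L" "(u, x) \<notin> Y" for u
    using L_sub assms(1,3) by auto
  have sub: "?Y \<subseteq> ?A \<times> ?A" using assms(3,4) by auto
  have none: "Y = {} \<longleftrightarrow> (\<forall>z\<in>B. \<not> chosen Y z)"
    using assms(3) by (auto simp: chosen_def)
  let ?Q = "\<lambda>A L Y u v. (v = u \<or> r u v) \<and> (\<forall>z\<in>A. (u, z) \<in> Y \<longrightarrow> z = v) \<and>
    (\<forall>z\<in>A. (u, z) \<in> L \<longrightarrow> \<not> r z u)"
  let ?R = "\<lambda>A L Y u v. (\<forall>z\<in>A. (u, z) \<in> L \<longrightarrow> \<not> chosen Y z) \<and> non_least (insert u {z \<in> A. (u, z) \<in> L}) r u v"
  have all: "(\<forall>u\<in>?A. \<forall>v\<in>?A. (u, v) \<in> ?Y \<longrightarrow> Q u v) \<longleftrightarrow> Q x y \<and> (\<forall>u\<in>B. \<forall>v\<in>B. (u, v) \<in> Y \<longrightarrow> Q u v)" for Q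
    using assms(1,3,4) by blast
  have ex: "(\<exists>u\<in>?A. \<exists>v\<in>?A. (u, v) \<in> ?Y \<and> R u v) \<longleftrightarrow> R x y \<or> (\<exists>u\<in>B. \<exists>v\<in>B. (u, v) \<in> Y \<and> R u v)" for R
    using assms(1,3,4) by blast
  have Qx: "?Q ?A ?L ?Y x y \<longleftrightarrow> (y = x \<or> r x y) \<and> (\<forall>z\<in>B. \<not> r z x)"
    unfolding Lx Yx using assms(1) by blast
  have Qu: "?Q ?A ?L ?Y u v \<longleftrightarrow> ?Q B L Y u v" if "u \<in> B" for u v
    unfolding Lu[OF that] Yu[OF that] using not_x[of u] by blast
  have Rx: "?R ?A ?L ?Y x y \<longleftrightarrow> Y = {} \<and> non_least ?A r x y"
    unfolding none sets(1) using Lx cu assms(1) by blast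
  have Ru: "?R ?A ?L ?Y u v \<longleftrightarrow> ?R B L Y u v" if "u \<in> B" for u v
    unfolding sets(2)[OF that] unfolding Lu[OF that] using not_x[of u] cu by blast
  have down: "(\<forall>u\<in>?A. \<forall>z\<in>?A. (u, z) \<in> ?L \<longrightarrow> chosen ?Y z \<longrightarrow> chosen ?Y u) \<longleftrightarrow>
      (\<forall>u\<in>B. \<forall>z\<in>B. (u, z) \<in> L \<longrightarrow> chosen Y z \<longrightarrow> chosen Y u)"
    using cx cu Lu not_x by (metis insert_iff)
  have 1: "witness ?A r ?L ?Y \<longleftrightarrow>
    ((y = x \<or> r x y) \<and> (\<forall>z\<in>B. \<not> r z x)) \<and>
    (\<forall>u\<in>B. \<forall>v\<in>B. (u, v) \<in> Y \<longrightarrow> ?Q B L Y u v) \<and>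
    (\<forall>u\<in>B. \<forall>z\<in>B. (u, z) \<in> L \<longrightarrow> chosen Y z \<longrightarrow> chosen Y u) \<and>
    ((Y = {} \<and> non_least ?A r x y) \<or> (\<exists>u\<in>B. \<exists>v\<in>B. (u, v) \<in> Y \<and> ?R B L Y u v))"
    unfolding witness_def all ex Qx Rx down using lin sub Qu Ru
    by (simp cong: ball_cong bex_cong)
  have 2: "witness B r L Y \<longleftrightarrow>
    (\<forall>u\<in>B. \<forall>v\<in>B. (u, v) \<in> Y \<longrightarrow>
        (v = u \<or> r u v) \<and> (\<forall>z\<in>B. (u, z) \<in> Y \<longrightarrow> z = v) \<and> (\<forall>z\<in>B. (u, z) \<in> L \<longrightarrow> \<not> r z u)) \<and>
    (\<forall>u\<in>B. \<forall>z\<in>B. (u, z) \<in> L \<longrightarrow> chosen Y z \<longrightarrow> chosen Y u) \<and>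
    (\<exists>u\<in>B. \<exists>v\<in>B. (u, v) \<in> Y \<and> (\<forall>z\<in>B. (u, z) \<in> L \<longrightarrow> \<not> chosen Y z) \<and>
        non_least (insert u {z\<in>B. (u, z) \<in> L}) r u v)"
    unfolding witness_def using assms(3,5) by simp
  have 3: "x \<in> minimals ?A r \<and> y \<in> upset ?A r x \<longleftrightarrow> (y = x \<or> r x y) \<and> (\<forall>z\<in>B. \<not> r z x)"
    using assms(2,4) by (auto simp: minimals_def upset_def)
  \<comment> \<open>Propositional glue: when the choices end at \<open>x\<close>, \<open>Y\<close>
    is empty and the clauses \<open>S\<close> and \<open>D\<close> hold vacuously.\<close>
  have "W = (a \<and> b \<and> (W' \<or> E))"
    if "W = (M \<and> S \<and> D \<and> (E \<or> X))" "W' = (S \<and> D \<and> X)" "(a \<and> b) = M" "E \<Longrightarrow> S \<and> D"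
    for W W' M S D E X a b
    using that by blast
  from this[OF 1 2 3] show ?thesis by (simp add: chosen_def)
qed

text \<open>Some element has a choice and such elements form an initial segment, so \<open>x\<close>
  has one too. Being minimal, \<open>x\<close> is not the choice of an element of \<open>B\<close>,
  and its own choice is unique; hence all other pairs stay inside \<open>B\<close>.\<close>

lemma witness_first:
  assumes "x \<notin> B" "linorder_rel B L" "witness (insert x B) r (cons_rel x B L) Y"
  obtains y Y' where "Y = insert (x, y) Y'" "Y' \<subseteq> B \<times> B" "y \<in> insert x B"
proof -
  let ?A = "insert x B" and ?L = "cons_rel x B L"
  note W = assms(3)[unfolded witness_def]
  have sub: "Y \<subseteq> ?A \<times> ?A"
    using W[THEN conjunct2, THEN conjunct1] .
  have loc: "(v = u \<or> r u v) \<and> (\<forall>z\<in>?A. (u, z) \<in> Y \<longrightarrow> z = v) \<and>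
      (\<forall>z\<in>?A. (u, z) \<in> ?L \<longrightarrow> \<not> r z u)" if "(u, v) \<in> Y" for u v
  proof -
    have "u \<in> ?A" "v \<in> ?A" using that sub by blast+
    from W[THEN conjunct2, THEN conjunct2, THEN conjunct1, THEN bspec, OF this(1),
        THEN bspec, OF this(2), THEN mp, OF that]
    show ?thesis .
  qed
  have down: "chosen Y u" if "u \<in> ?A" "z \<in> ?A" "(u, z) \<in> ?L" "chosen Y z" for u z
    using W[THEN conjunct2, THEN conjunct2, THEN conjunct2, THEN conjunct1] that by blast
  have ex: "\<exists>u\<in>?A. \<exists>v\<in>?A. (u, v) \<in> Y"
    using W[THEN conjunct2, THEN conjunct2, THEN conjunct2, THEN conjunct2] by (elim bexE conjE) blast
  have L: "(x, z) \<in> ?L" if "z \<in> B" for z using that by (simp add: cons_rel_def)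
  from ex obtain u v where uv: "u \<in> ?A" "(u, v) \<in> Y" by blast
  have "chosen Y x"
  proof (cases "u = x")
    case True
    then show ?thesis using uv by (auto simp: chosen_def)
  next
    case False
    then show ?thesis using down[of x u] uv L by (auto simp: chosen_def)
  qed
  then obtain y where y: "(x, y) \<in> Y" by (auto simp: chosen_def)
  have min: "\<not> r z x" if "z \<in> B" for z
    using loc[OF y] L[OF that] that by blast
  have "p \<in> B \<times> B" if p: "p \<in> Y - {(x, y)}" for p
  proof -
    obtain u v where uv: "p = (u, v)" by fastforce
    have Y: "(u, v) \<in> Y" "(u, v) \<noteq> (x, y)" "v \<in> ?A" "u \<in> ?A" using p uv sub by auto
    have "u \<noteq> x" using loc[OF y] Y by blast
    then have u: "u \<in> B" using Y by blast
    then have "v \<noteq> x" using loc[OF Y(1)] min assms(1) by blast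
    then show ?thesis using u Y uv by blast
  qed
  then have "Y - {(x, y)} \<subseteq> B \<times> B" by blast
  moreover have "Y = insert (x, y) (Y - {(x, y)})" using y by blast
  moreover have "y \<in> ?A" using y sub by blast
  ultimately show ?thesis using that by blast
qed

definition num_witness :: "nat set \<Rightarrow> (nat \<Rightarrow> nat \<Rightarrow> bool) \<Rightarrow> nat" where
  "num_witness A r = card {(L, Y). witness A r L Y}"

lemma witness_nonempty: "\<not> witness A r L {}"
  by (auto simp: witness_def)

lemma num_witness_empty: "num_witness {} r = 0"
  by (simp add: num_witness_def witness_def)

text \<open>Witnesses are sorted by their first element \<open>x\<close> and its choice
  \<open>y\<close>. \<open>?W\<close> collects those that go on, \<open>?O\<close> those that stop
  at \<open>x\<close>, where any order of the other elements completes \<open>L\<close>.\<close>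

lemma num_witness_rec:
  assumes "finite A" "A \<noteq> {}" "irreflp_on A r"
  shows "num_witness A r = (\<Sum>x\<in>minimals A r. \<Sum>y\<in>upset A r x.
    num_witness (A - {x}) r + (if non_least A r x y then fact (card A - 1) else 0))"
proof -
  let ?W = "\<lambda>x. {(L, Y). witness (A - {x}) r L Y}"
  let ?O = "\<lambda>x y. {L. linorder_rel (A - {x}) L \<and> non_least A r x y} \<times> {{} :: (nat \<times> nat) set}"
  let ?S = "SIGMA x:minimals A r. SIGMA y:upset A r x. ?W x \<union> ?O x y"
  let ?h = "\<lambda>(x, y, L, Y). (cons_rel x (A - {x}) L, insert (x, y) Y)"
  have irr: "\<And>x. x \<in> A \<Longrightarrow> \<not> r x x" using assms(3) by (auto simp: irreflp_on_def)
  have mem: "x \<in> A" if "x \<in> minimals A r" for x using that by (simp add: minimals_def)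
  have up: "y \<in> A" if "y \<in> upset A r x" for x y using that by (simp add: upset_def)
  have inner: "linorder_rel (A - {x}) L \<and> Y \<subseteq> (A - {x}) \<times> (A - {x})"
    if "(L, Y) \<in> ?W x \<union> ?O x y" for x y L Y
    using that by (auto simp: witness_def)
  have iff: "witness A r (cons_rel x (A - {x}) L) (insert (x, y) Y) \<longleftrightarrow>
      x \<in> minimals A r \<and> y \<in> upset A r x \<and> (L, Y) \<in> ?W x \<union> ?O x y"
    if "x \<in> A" "y \<in> A" "linorder_rel (A - {x}) L" "Y \<subseteq> (A - {x}) \<times> (A - {x})" for x y L Y
    using witness_cons[of x "A - {x}" r Y y L] that irr[OF that(1)]
    by (auto simp: insert_absorb)
  have "?h ` ?S = {(L, Y). witness A r L Y}"
  proof (intro equalityI subsetI)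
    fix p assume "p \<in> ?h ` ?S"
    then obtain q where q: "p = ?h q" "q \<in> ?S" by (rule imageE)
    obtain x y L Y where q': "q = (x, y, L, Y)" by (metis prod.exhaust)
    have p: "p = (cons_rel x (A - {x}) L, insert (x, y) Y)"
      using q(1) unfolding q' by simp
    have "x \<in> minimals A r \<and> y \<in> upset A r x \<and> (L, Y) \<in> ?W x \<union> ?O x y"
      using q(2) unfolding q' mem_Sigma_iff .
    then have xy: "x \<in> minimals A r" "y \<in> upset A r x" "(L, Y) \<in> ?W x \<union> ?O x y"
      by blast+
    have "witness A r (cons_rel x (A - {x}) L) (insert (x, y) Y)"
      using iff[of x y L Y] inner[OF xy(3)] mem[OF xy(1)] up[OF xy(2)] xy by blast
    then show "p \<in> {(L, Y). witness A r L Y}" using p by simp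
  next
    fix p assume "p \<in> {(L, Y). witness A r L Y}"
    then obtain L Y where p: "p = (L, Y)" and w: "witness A r L Y" by blast
    have "linorder_rel A L" using w by (simp add: witness_def)
    then obtain x L' where x: "x \<in> A" "L = cons_rel x (A - {x}) L'" "linorder_rel (A - {x}) L'"
      using linorder_rel_decomp[OF assms(1,2)] by blast
    have "witness (insert x (A - {x})) r (cons_rel x (A - {x}) L') Y"
      using w x by (simp add: insert_absorb)
    then obtain y Y' where y: "Y = insert (x, y) Y'" "Y' \<subseteq> (A - {x}) \<times> (A - {x})"
      "y \<in> insert x (A - {x})"
      using witness_first[of x "A - {x}" L' r Y] x(3) by blast
    then have "y \<in> A" using x(1) by blast
    then have "x \<in> minimals A r \<and> y \<in> upset A r x \<and> (L', Y') \<in> ?W x \<union> ?O x y"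
      using iff[OF x(1) _ x(3) y(2)] w unfolding x(2) y(1) by blast
    then have "(x, y, L', Y') \<in> ?S" unfolding mem_Sigma_iff .
    then have "?h (x, y, L', Y') \<in> ?h ` ?S" by (rule imageI)
    then show "p \<in> ?h ` ?S" using p x(2) y(1) by simp
  qed
  moreover have "inj_on ?h ?S"
  proof (rule inj_onI)
    fix p q assume p: "p \<in> ?S" and q: "q \<in> ?S" and eq: "?h p = ?h q"
    obtain x y L Y where p': "p = (x, y, L, Y)" by (metis prod.exhaust)
    obtain x' y' L' Y' where q': "q = (x', y', L', Y')" by (metis prod.exhaust)
    have 1: "x \<in> A" "linorder_rel (A - {x}) L \<and> Y \<subseteq> (A - {x}) \<times> (A - {x})"
      using p inner[of L Y x y] mem[of x] unfolding p' mem_Sigma_iff by blast+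
    have 2: "x' \<in> A" "linorder_rel (A - {x'}) L' \<and> Y' \<subseteq> (A - {x'}) \<times> (A - {x'})"
      using q inner[of L' Y' x' y'] mem[of x'] unfolding q' mem_Sigma_iff by blast+
    have eqs: "cons_rel x (A - {x}) L = cons_rel x' (A - {x'}) L'"
      "insert (x, y) Y = insert (x', y') Y'"
      using eq unfolding p' q' by auto
    have xL: "x = x' \<and> L = L'"
      using eqs(1) 1 2 by (intro cons_rel_inj) blast+
    \<comment> \<open>No pair of \<open>Y\<close> or \<open>Y'\<close> starts with \<open>x\<close>,
      so \<open>y\<close> can be read off from the combined set.\<close>
    then have "(x, y) \<notin> Y" "(x', y') \<notin> Y'" "(x, y') \<notin> Y" "(x, y) \<notin> Y'" using 1 2 by blast+
    then have "y = y' \<and> Y = Y'" using eqs(2) xL by (metis Pair_inject insertE insertI1 insert_ident)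
    then show "p = q" using xL p' q' by simp
  qed
  ultimately have "num_witness A r = card ?S"
    unfolding num_witness_def by (metis (no_types, lifting) card_image)
  also have "\<dots> = (\<Sum>x\<in>minimals A r. \<Sum>y\<in>upset A r x. card (?W x \<union> ?O x y))"
  proof -
    have fin: "finite (minimals A r)" "finite (upset A r x)" "finite (?W x \<union> ?O x y)" for x y
      using assms(1) finite_witness[of "A - {x}" r] finite_linorder_rel[of "A - {x}"]
      by (auto simp: minimals_def upset_def)
    then show ?thesis
      by (subst card_SigmaI; simp add: card_SigmaI)
  qed
  also have "\<dots> = (\<Sum>x\<in>minimals A r. \<Sum>y\<in>upset A r x.
    num_witness (A - {x}) r + (if non_least A r x y then fact (card A - 1) else 0))"
  proof (intro sum.cong refl)
    fix x y assume x: "x \<in> minimals A r" and y: "y \<in> upset A r x"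
    have disj: "?W x \<inter> ?O x y = {}" using witness_nonempty by auto
    have fin: "finite (?W x)" "finite (?O x y)"
      using assms(1) finite_witness[of "A - {x}" r] finite_linorder_rel[of "A - {x}"] by auto
    have "card (?W x \<union> ?O x y) = card (?W x) + card (?O x y)"
      using fin disj by (rule card_Un_disjoint)
    also have "card (?W x) = num_witness (A - {x}) r" by (simp add: num_witness_def)
    also have "card (?O x y) = (if non_least A r x y then fact (card A - 1) else 0)"
      using card_linorder_rel[of "A - {x}"] assms(1) mem[OF x] by (simp add: card_cartesian_product)
    finally show "card (?W x \<union> ?O x y) =
      num_witness (A - {x}) r + (if non_least A r x y then fact (card A - 1) else 0)" .
  qed
  finally show ?thesis .
qed

text \<open>Every \<open>y\<close> falls into the class of the least minimal element below it and
  into no other. The resulting \<open>card A\<close> is the factor that turns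
  \<open>(|A| - 1)!\<close> into \<open>|A|!\<close>.\<close>

lemma sum_card_least:
  assumes "finite_poset A r"
  shows "(\<Sum>x\<in>minimals A r. card {y \<in> upset A r x. \<not> non_least A r x y}) = card A"
proof -
  have fin: "finite A" using assms by (simp add: finite_poset_def)
  let ?B = "\<lambda>x. {y \<in> upset A r x. \<not> non_least A r x y}"
  let ?low = "\<lambda>y z. z \<in> minimals A r \<and> (z = y \<or> r z y)"
  have "A = (\<Union>x\<in>minimals A r. ?B x)"
  proof (intro equalityI subsetI)
    fix y assume y: "y \<in> A"
    then have ex: "\<exists>z. ?low y z" using ex_minimal_below[OF assms] by blast
    define z where "z = (LEAST z. ?low y z)"
    have z: "?low y z" "\<And>z'. z' < z \<Longrightarrow> \<not> ?low y z'"
      unfolding z_def by (rule LeastI_ex[OF ex]) (rule not_less_Least)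
    have "y \<in> ?B z"
      using z y unfolding non_least_def upset_def by blast
    then show "y \<in> (\<Union>x\<in>minimals A r. ?B x)" using z(1) by blast
  qed (auto simp: upset_def)
  then have "card A = card (\<Union>x\<in>minimals A r. ?B x)" by simp
  also have "\<dots> = (\<Sum>x\<in>minimals A r. card (?B x))"
  proof (rule card_UN_disjoint)
    show "finite (minimals A r)" using fin by (simp add: minimals_def)
    show "\<forall>x\<in>minimals A r. finite (?B x)" using fin by (simp add: upset_def)
    show "\<forall>x\<in>minimals A r. \<forall>x'\<in>minimals A r. x \<noteq> x' \<longrightarrow> ?B x \<inter> ?B x' = {}"
    proof (intro ballI impI equals0I)
      fix x x' y
      assume x: "x \<in> minimals A r" "x' \<in> minimals A r" "x \<noteq> x'" "y \<in> ?B x \<inter> ?B x'"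
      then have "x = y \<or> r x y" "x' = y \<or> r x' y" "\<not> non_least A r x y" "\<not> non_least A r x' y"
        by (auto simp: upset_def)
      moreover have "x < x' \<or> x' < x" using x(3) by linarith
      ultimately show False using x(1,2) unfolding non_least_def by blast
    qed
  qed
  finally show ?thesis by simp
qed

text \<open>Stated additively to stay in the natural numbers; it exhibits \<open>xi\<close> as a
  number of witnesses and thereby proves it nonnegative.\<close>

theorem num_linext_prod_upper_size:
  assumes "finite_poset A r"
  shows "num_linext A r * (\<Prod>x\<in>A. upper_size A r x) = fact (card A) + num_witness A r"
  using assms
proof (induction "card A" arbitrary: A)
  case 0
  then have "A = {}" by (simp add: finite_poset_def)
  moreover have "linear_extensions {} r = {\<lambda>_. undefined}"
    by (auto simp: linear_extensions_def bij_betw_def)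
  ultimately show ?case by (simp add: num_linext_def num_witness_empty)
next
  case (Suc m)
  have fin: "finite A" and irr: "irreflp_on A r" using Suc.prems by (auto simp: finite_poset_def)
  have ne: "A \<noteq> {}" using Suc.hyps(2) by auto
  let ?M = "minimals A r" and ?b = "upper_size A r"
  have b: "?b x = card (upset A r x)" for x
    by (simp add: upper_size_def upset_def)
  have step: "num_linext (A - {x}) r * (\<Prod>z\<in>A. ?b z) = ?b x * (fact m + num_witness (A - {x}) r)"
    if x: "x \<in> ?M" for x
  proof -
    have xA: "x \<in> A" and min: "\<And>z. z \<in> A \<Longrightarrow> \<not> r z x" using x by (auto simp: minimals_def)
    \<comment> \<open>A minimal \<open>x\<close> is in no up-set but its own.\<close>
    have "upper_size (A - {x}) r z = ?b z" if "z \<in> A - {x}" for z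
      unfolding upper_size_def using min[of z] that by (intro arg_cong[of _ _ card]) auto
    then have "(\<Prod>z\<in>A. ?b z) = ?b x * (\<Prod>z\<in>A - {x}. upper_size (A - {x}) r z)"
      using fin xA by (simp add: prod.remove[of A x])
    moreover have "card (A - {x}) = m" using Suc.hyps(2) xA fin by simp
    moreover have "finite_poset (A - {x}) r" using Suc.prems by (rule finite_poset_subset) blast
    ultimately show ?thesis using Suc.hyps(1)[of "A - {x}"] by simp
  qed
  have split: "?b x = card {y \<in> upset A r x. non_least A r x y} + card {y \<in> upset A r x. \<not> non_least A r x y}" for x
  proof -
    have "finite (upset A r x)" using fin by (simp add: upset_def)
    then show ?thesis unfolding b
      by (subst card_Un_disjoint[symmetric]) (auto intro: arg_cong[of _ _ card])
  qed
  have "num_linext A r * (\<Prod>x\<in>A. ?b x) = (\<Sum>x\<in>?M. ?b x * (fact m + num_witness (A - {x}) r))"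
    using step by (simp add: num_linext_rec[OF fin ne] sum_distrib_right)
  \<comment> \<open>Only the \<open>fact m\<close> part is split by \<open>non_least\<close>: the
    least choices sum to \<open>fact m * card A\<close>, the others join the recursion for
    \<open>num_witness\<close>.\<close>
  also have "\<dots> = (\<Sum>x\<in>?M. fact m * card {y \<in> upset A r x. \<not> non_least A r x y} +
      (?b x * num_witness (A - {x}) r + fact m * card {y \<in> upset A r x. non_least A r x y}))"
    by (intro sum.cong refl) (simp add: split algebra_simps)
  also have "\<dots> = fact m * card A +
      (\<Sum>x\<in>?M. ?b x * num_witness (A - {x}) r + fact m * card {y \<in> upset A r x. non_least A r x y})"
    unfolding sum.distrib[of _ _ ?M] sum_distrib_left[symmetric]
    by (simp add: sum_card_least[OF Suc.prems])
  also have "(\<Sum>x\<in>?M. ?b x * num_witness (A - {x}) r + fact m * card {y \<in> upset A r x. non_least A r x y})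
      = num_witness A r"
  proof -
    have "finite (upset A r x)" for x using fin by (simp add: upset_def)
    then show ?thesis
      unfolding num_witness_rec[OF fin ne irr] b
      by (simp add: sum.distrib sum.If_cases Suc.hyps(2)[symmetric] Int_def mult.commute)
  qed
  also have "fact m * card A = fact (card A)" by (simp flip: Suc.hyps(2))
  finally show ?case .
qed

section \<open>The formula that recognises witnesses\<close>

definition Disj :: "fm \<Rightarrow> fm \<Rightarrow> fm" where "Disj \<phi> \<psi> = Neg (Conj (Neg \<phi>) (Neg \<psi>))"
definition Imp :: "fm \<Rightarrow> fm \<Rightarrow> fm" where "Imp \<phi> \<psi> = Neg (Conj \<phi> (Neg \<psi>))"
definition Exists :: "fm \<Rightarrow> fm" where "Exists \<phi> = Neg (Forall (Neg \<phi>))"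
definition Eq :: "nat \<Rightarrow> nat \<Rightarrow> fm" where "Eq i j = Conj (Leq i j) (Leq j i)"

lemma sat_connectives [simp]:
  "sat w d (Disj \<phi> \<psi>) \<rho> \<longleftrightarrow> sat w d \<phi> \<rho> \<or> sat w d \<psi> \<rho>"
  "sat w d (Imp \<phi> \<psi>) \<rho> \<longleftrightarrow> (sat w d \<phi> \<rho> \<longrightarrow> sat w d \<psi> \<rho>)"
  "sat w d (Exists \<phi>) \<rho> \<longleftrightarrow> (\<exists>a<\<rho> 0. sat w (Suc d) \<phi> (\<rho>(d := a)))"
  "sat w d (Eq i j) \<rho> \<longleftrightarrow> \<rho> i = \<rho> j"
  by (auto simp: Disj_def Imp_def Exists_def Eq_def)

text \<open>The offsets follow the word: \<open>n\<close> ones, a zero, the order matrix, the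
  separator, the matrices of \<open>L\<close> and \<open>Y\<close>. \<open>Times 1\<close> is
  \<open>n * n\<close>, as both factors are constants equal to \<open>n\<close>; symbol
  \<open>2\<close> is the bit \<open>True\<close>.\<close>

definition Order_fm :: "nat \<Rightarrow> nat \<Rightarrow> fm" where
  "Order_fm i j = Cell [Unit, Var 0, Times i, Var j] 2"
definition Linear_fm :: "nat \<Rightarrow> nat \<Rightarrow> fm" where
  "Linear_fm i j = Cell [Unit, Unit, Var 0, Times 1, Times i, Var j] 2"
definition Choice_fm :: "nat \<Rightarrow> nat \<Rightarrow> fm" where
  "Choice_fm i j = Cell [Unit, Unit, Var 0, Times 1, Times 1, Times i, Var j] 2"

text \<open>
  The block \<open>1\<^sup>n 0\<close>, the separator after the \<open>n * n\<close> entries of the order, and a witness of length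
  exactly \<open>2 * (n * n)\<close>.
\<close>

definition shape_fm :: fm where
  "shape_fm = Conj (Cell [Var 0] 1) (Conj (Cell [Unit, Var 0, Times 1] 3)
     (Conj (Neg (Cell [Unit, Var 0, Times 1, Times 1, Times 1] 0))
        (Cell [Unit, Unit, Var 0, Times 1, Times 1, Times 1] 0)))"

text \<open>Checked by the verifier itself, so that the matrix of a relation that is no strict order
  gets no witnesses.\<close>

definition poset_fm :: fm where
  "poset_fm = Conj (Forall (Neg (Order_fm 2 2)))
     (Forall (Forall (Forall (Imp (Order_fm 2 3) (Imp (Order_fm 3 4) (Order_fm 2 4))))))"

definition linorder_fm :: fm where
  "linorder_fm = Conj (Forall (Neg (Linear_fm 2 2)))
     (Conj (Forall (Forall (Disj (Eq 2 3) (Disj (Linear_fm 2 3) (Linear_fm 3 2)))))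
        (Forall (Forall (Forall (Imp (Linear_fm 2 3) (Imp (Linear_fm 3 4) (Linear_fm 2 4)))))))"

definition choice_fm :: fm where
  "choice_fm = Forall (Forall (Imp (Choice_fm 2 3) (Conj (Disj (Eq 3 2) (Order_fm 2 3))
     (Conj (Forall (Imp (Choice_fm 2 4) (Eq 4 3))) (Forall (Imp (Linear_fm 2 4) (Neg (Order_fm 4 2))))))))"

definition down_fm :: fm where
  "down_fm = Forall (Forall (Imp (Linear_fm 2 3) (Imp (Exists (Choice_fm 3 4)) (Exists (Choice_fm 2 4)))))"

text \<open>\<open>non_least\<close> is unfolded in the form given by
  \<open>non_least_rest_iff\<close>, because the language has no quantifiers over sets.
  \<open>Neg (Leq 2 4)\<close> says that variable \<open>4\<close> is the smaller one.\<close>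

definition last_fm :: fm where
  "last_fm = Exists (Exists (Conj (Choice_fm 2 3)
     (Conj (Forall (Imp (Linear_fm 2 4) (Neg (Exists (Choice_fm 4 5)))))
        (Exists (Conj (Linear_fm 2 4) (Conj (Neg (Leq 2 4)) (Conj (Disj (Eq 4 3) (Order_fm 4 3))
           (Conj (Neg (Order_fm 2 4)) (Forall (Imp (Linear_fm 2 5) (Neg (Order_fm 5 4))))))))))))"

definition witness_fm :: fm where
  "witness_fm = Conj shape_fm (Conj poset_fm
     (Conj linorder_fm (Conj choice_fm (Conj down_fm last_fm))))"

lemmas fm_defs = Disj_def Imp_def Exists_def Eq_def Order_fm_def Linear_fm_def Choice_fm_def
  shape_fm_def poset_fm_def linorder_fm_def choice_fm_def down_fm_def last_fm_def witness_fm_def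

text \<open>The deepest quantifiers bind variable \<open>5\<close>, so six variables and nine tapes
  suffice.\<close>

lemma fm_ok_witness_fm: "fm_ok 6 2 witness_fm"
  by (simp add: fm_defs)

section \<open>Reading the order and the witness off the word\<close>

definition entry :: "nat list \<Rightarrow> nat \<Rightarrow> nat \<Rightarrow> nat \<Rightarrow> bool" where
  "entry w k i j \<longleftrightarrow> cell w (k + (i * unary_prefix w + j)) = 2"

definition order_of :: "nat list \<Rightarrow> nat \<Rightarrow> nat \<Rightarrow> bool" where
  "order_of w i j = entry w (unary_prefix w + 1) i j"

definition linear_of :: "nat list \<Rightarrow> (nat \<times> nat) set" where
  "linear_of w = {(i, j). i < unary_prefix w \<and> j < unary_prefix w \<and>
     entry w (unary_prefix w + 2 + unary_prefix w ^ 2) i j}"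

definition choice_of :: "nat list \<Rightarrow> (nat \<times> nat) set" where
  "choice_of w = {(i, j). i < unary_prefix w \<and> j < unary_prefix w \<and>
     entry w (unary_prefix w + 2 + 2 * unary_prefix w ^ 2) i j}"

lemma sat_entries:
  assumes "\<rho> 0 = unary_prefix w"
  shows "sat w d (Order_fm i j) \<rho> \<longleftrightarrow> order_of w (\<rho> i) (\<rho> j)"
    and "\<rho> 1 = unary_prefix w \<Longrightarrow> \<rho> i < unary_prefix w \<Longrightarrow> \<rho> j < unary_prefix w \<Longrightarrow>
      sat w d (Linear_fm i j) \<rho> \<longleftrightarrow> (\<rho> i, \<rho> j) \<in> linear_of w"
    and "\<rho> 1 = unary_prefix w \<Longrightarrow> \<rho> i < unary_prefix w \<Longrightarrow> \<rho> j < unary_prefix w \<Longrightarrow>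
      sat w d (Choice_fm i j) \<rho> \<longleftrightarrow> (\<rho> i, \<rho> j) \<in> choice_of w"
  using assms
  by (simp_all add: Order_fm_def Linear_fm_def Choice_fm_def order_of_def linear_of_def
      choice_of_def entry_def power2_eq_square algebra_simps numeral_eq_Suc)

lemma start_val_simps [simp]:
  "start_val w 0 = unary_prefix w" "start_val w (Suc 0) = unary_prefix w"
  by (simp_all add: start_val_def)

lemma sat_poset_fm:
  "sat w 2 poset_fm (start_val w) \<longleftrightarrow> finite_poset {..<unary_prefix w} (order_of w)"
  unfolding poset_fm_def finite_poset_def irreflp_on_def transp_on_def
  by (simp add: sat_entries Ball_def) blast

lemma linear_of_subset: "linear_of w \<subseteq> {..<unary_prefix w} \<times> {..<unary_prefix w}"
  by (auto simp: linear_of_def)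

lemma choice_of_subset: "choice_of w \<subseteq> {..<unary_prefix w} \<times> {..<unary_prefix w}"
  by (auto simp: choice_of_def)

lemma chosen_choice_of: "chosen (choice_of w) x \<longleftrightarrow> (\<exists>y<unary_prefix w. (x, y) \<in> choice_of w)"
  using choice_of_subset[of w] by (auto simp: chosen_def)

lemma sat_linorder_fm:
  "sat w 2 linorder_fm (start_val w) \<longleftrightarrow> linorder_rel {..<unary_prefix w} (linear_of w)"
  unfolding linorder_fm_def linorder_rel_def Ball_def lessThan_iff
  by (simp add: sat_entries linear_of_subset)

lemma sat_choice_fm:
  "sat w 2 choice_fm (start_val w) \<longleftrightarrow>
    (\<forall>x\<in>{..<unary_prefix w}. \<forall>y\<in>{..<unary_prefix w}. (x, y) \<in> choice_of w \<longrightarrow>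
      (y = x \<or> order_of w x y) \<and>
      (\<forall>z\<in>{..<unary_prefix w}. (x, z) \<in> choice_of w \<longrightarrow> z = y) \<and>
      (\<forall>z\<in>{..<unary_prefix w}. (x, z) \<in> linear_of w \<longrightarrow> \<not> order_of w z x))"
  unfolding choice_fm_def Ball_def lessThan_iff
  by (simp add: sat_entries)

lemma sat_down_fm:
  "sat w 2 down_fm (start_val w) \<longleftrightarrow>
    (\<forall>x\<in>{..<unary_prefix w}. \<forall>z\<in>{..<unary_prefix w}. (x, z) \<in> linear_of w \<longrightarrow>
      chosen (choice_of w) z \<longrightarrow> chosen (choice_of w) x)"
  unfolding down_fm_def Ball_def lessThan_iff chosen_choice_of
  by (simp add: sat_entries cong: conj_cong)

text \<open>\<open>z < x\<close> places \<open>z\<close> among the elements after \<open>x\<close>,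
  and the inserted element contributes the conjunct \<open>\<not> r x z\<close>.\<close>

lemma non_least_rest_iff:
  "non_least (insert x {z\<in>A. (x, z) \<in> L}) r x y \<longleftrightarrow>
    (\<exists>z\<in>A. (x, z) \<in> L \<and> z < x \<and> (z = y \<or> r z y) \<and> \<not> r x z \<and> (\<forall>u\<in>A. (x, u) \<in> L \<longrightarrow> \<not> r u z))"
  unfolding non_least_def minimals_def by auto

lemma sat_last_fm:
  "sat w 2 last_fm (start_val w) \<longleftrightarrow>
    (\<exists>x\<in>{..<unary_prefix w}. \<exists>y\<in>{..<unary_prefix w}. (x, y) \<in> choice_of w \<and>
      (\<forall>z\<in>{..<unary_prefix w}. (x, z) \<in> linear_of w \<longrightarrow> \<not> chosen (choice_of w) z) \<and>
      non_least (insert x {z\<in>{..<unary_prefix w}. (x, z) \<in> linear_of w}) (order_of w) x y)"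
  unfolding non_least_rest_iff
  unfolding last_fm_def Ball_def Bex_def lessThan_iff chosen_choice_of
  by (simp add: sat_entries not_le cong: conj_cong)

definition shape :: "nat list \<Rightarrow> bool" where
  "shape w \<longleftrightarrow> sat w 2 shape_fm (start_val w)"

lemma sat_witness_fm:
  "sat w 2 witness_fm (start_val w) \<longleftrightarrow> shape w \<and>
    finite_poset {..<unary_prefix w} (order_of w) \<and>
    witness {..<unary_prefix w} (order_of w) (linear_of w) (choice_of w)"
  unfolding witness_fm_def witness_def sat.simps shape_def sat_poset_fm sat_linorder_fm
    sat_choice_fm sat_down_fm sat_last_fm
  by (simp only: choice_of_subset simp_thms)

section \<open>Lengths and entries of encoded posets\<close>

lemma length_concat_rows: "length (concat (map (\<lambda>i. map (r i) [0..<n]) [0..<m])) = m * n"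
  by (induction m) simp_all

lemma nth_concat_rows:
  "p < m * n \<Longrightarrow> concat (map (\<lambda>i. map (r i) [0..<n]) [0..<m]) ! p = r (p div n) (p mod n)"
proof (induction m)
  case (Suc m)
  show ?case
  proof (cases "p < m * n")
    case True
    then show ?thesis using Suc.IH by (simp add: nth_append length_concat_rows)
  next
    case False
    then obtain q where q: "p = q + m * n" by (metis add.commute le_Suc_ex not_less)
    then have "q < n" using Suc.prems by simp
    then show ?thesis unfolding q by (simp add: nth_append length_concat_rows)
  qed
qed simp

lemma length_poset_code: "length (poset_code n r) = n + 1 + n * n"
  by (simp add: poset_code_def length_concat_rows)

lemma matrix_index_less: "i < n \<Longrightarrow> j < n \<Longrightarrow> i * n + j < n * (n :: nat)"
proof -
  assume ij: "i < n" "j < n"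
  then have "i * n + j < Suc i * n" by simp
  also have "\<dots> \<le> n * n" using ij by (intro mult_le_mono) auto
  finally show ?thesis .
qed

lemma nth_poset_code:
  "i < n \<Longrightarrow> poset_code n r ! i = True"
  "poset_code n r ! n = False"
  "i < n \<Longrightarrow> j < n \<Longrightarrow> poset_code n r ! (n + 1 + (i * n + j)) = r i j"
  using matrix_index_less[of i n j]
  by (auto simp: poset_code_def nth_append nth_concat_rows)

lemma poset_code_eqI:
  assumes "length x = n + 1 + n * n" "\<And>i. i < n \<Longrightarrow> x ! i" "\<not> x ! n"
  shows "x = poset_code n (\<lambda>i j. x ! (n + 1 + (i * n + j)))"
proof (rule nth_equalityI)
  show "length x = length (poset_code n (\<lambda>i j. x ! (n + 1 + (i * n + j))))"
    by (simp add: assms(1) length_poset_code)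
  fix p assume p: "p < length x"
  have "p < n \<or> p = n \<or> p = n + 1 + (p - n - 1) \<and> p - n - 1 < n * n"
    using p assms(1) by linarith
  then consider "p < n" | "p = n" | q where "p = n + 1 + q" "q < n * n"
    by blast
  then show "x ! p = poset_code n (\<lambda>i j. x ! (n + 1 + (i * n + j))) ! p"
  proof cases
    case 1
    then show ?thesis using assms(2)[OF 1] nth_poset_code(1)[OF 1] by simp
  next
    case 2
    then show ?thesis using assms(3) by (simp add: nth_poset_code(2))
  next
    case 3
    have "0 < n" using 3(2) by (cases n) auto
    then have "q div n < n" "q mod n < n"
      using 3(2) by (simp_all add: less_mult_imp_div_less)
    from nth_poset_code(3)[OF this, of "\<lambda>i j. x ! (n + 1 + (i * n + j))"] 3(1) show ?thesis by simp
  qed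
qed

lemma cell_pair_word:
  "cell (pair_word x y) p =
    (if p < length x then bit_symbol (x ! p) else if p = length x then 3
     else if p < length x + 1 + length y then bit_symbol (y ! (p - length x - 1)) else 0)"
proof (cases "p \<le> length x")
  case True
  then show ?thesis
    by (auto simp: cell_def pair_word_def nth_append separator_def)
next
  case False
  then obtain q where "p = length x + 1 + q" by (metis add.assoc less_iff_Suc_add not_le plus_1_eq_Suc add.commute)
  then show ?thesis
    by (simp add: cell_def pair_word_def nth_append)
qed

text \<open>The separator ends the block of symbols \<open>2\<close>, so a malformed
  \<open>x\<close> cannot borrow ones from the witness.\<close>

lemma prefix_pair_word:
  assumes "i < unary_prefix (pair_word x y)"
  shows "i < length x \<and> x ! i"
proof -
  have two: "cell (pair_word x y) k = 2" if "k \<le> i" for k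
    using nth_unary_prefix[of k] that assms by simp
  have "i < length x"
  proof (rule ccontr)
    assume "\<not> i < length x"
    then show False using two[of "length x"] by (simp add: cell_pair_word)
  qed
  then show ?thesis
    using two[of i] by (simp add: cell_pair_word bit_symbol_def split: if_splits)
qed

lemma unary_prefix_eqI:
  assumes "\<And>k. k < n \<Longrightarrow> cell w k = 2" "cell w n \<noteq> 2"
  shows "unary_prefix w = n"
  using assms nth_unary_prefix[of n w] cell_unary_prefix[of w]
  by (metis linorder_neqE_nat)

lemma bit_symbol_neq [simp]: "bit_symbol b \<noteq> 0" "bit_symbol b \<noteq> 3" "bit_symbol b = Suc 0 \<longleftrightarrow> \<not> b"
  "bit_symbol b = 2 \<longleftrightarrow> b"
  by (simp_all add: bit_symbol_def)

text \<open>The separator occurs only once, so finding it at a given position fixes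
  \<open>length x\<close>. Blanks occur only past the end, so a nonblank cell followed by a blank
  one fixes \<open>length y\<close>; for \<open>n = 0\<close> that nonblank cell is the
  separator.\<close>

lemma shape_pair_word:
  fixes x y
  defines "n \<equiv> unary_prefix (pair_word x y)"
  shows "shape (pair_word x y) \<longleftrightarrow>
    length x = n + 1 + n * n \<and> (\<forall>i<n. x ! i) \<and> \<not> x ! n \<and> length y = 2 * (n * n)"
proof -
  let ?w = "pair_word x y"
  have pre: "i < length x \<and> x ! i" if "i < n" for i
    using prefix_pair_word[of i x y] that by (simp add: n_def)
  have sh: "shape ?w \<longleftrightarrow> cell ?w n = 1 \<and> cell ?w (n + 1 + n * n) = 3 \<and>
      cell ?w (n + 1 + 3 * (n * n)) \<noteq> 0 \<and> cell ?w (n + 2 + 3 * (n * n)) = 0"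
    unfolding shape_def shape_fm_def
    by (simp add: n_def[symmetric] numeral_eq_Suc algebra_simps)
  have n_le: "n \<le> length x"
    using pre[of "length x"] by (cases "length x < n") auto
  have 1: "cell ?w n = 1 \<longleftrightarrow> n < length x \<and> \<not> x ! n"
    using n_le by (auto simp: cell_pair_word)
  have 2: "cell ?w p = 3 \<longleftrightarrow> p = length x" for p
    by (auto simp: cell_pair_word)
  have 3: "cell ?w p = 0 \<longleftrightarrow> length x + 1 + length y \<le> p" for p
    by (auto simp: cell_pair_word)
  show ?thesis
    unfolding sh 1 2 3 using pre by auto
qed

lemma unary_prefix_poset_code: "unary_prefix (pair_word (poset_code n r) y) = n"
  by (rule unary_prefix_eqI) (simp_all add: cell_pair_word length_poset_code nth_poset_code)

lemma order_of_poset_code: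
  "i < n \<Longrightarrow> j < n \<Longrightarrow> order_of (pair_word (poset_code n r) y) i j = r i j"
  using matrix_index_less[of i n j] nth_poset_code(3)[of i n j r]
  by (simp add: order_of_def entry_def unary_prefix_poset_code cell_pair_word length_poset_code)

section \<open>Witnesses as bit strings\<close>

definition decode :: "nat \<Rightarrow> bool list \<Rightarrow> (nat \<times> nat) set \<times> (nat \<times> nat) set" where
  "decode n y = ({(i, j). i < n \<and> j < n \<and> y ! (i * n + j)},
     {(i, j). i < n \<and> j < n \<and> y ! (n * n + (i * n + j))})"

definition encode :: "nat \<Rightarrow> (nat \<times> nat) set \<times> (nat \<times> nat) set \<Rightarrow> bool list" where
  "encode n LY = map (\<lambda>p. (p div n, p mod n) \<in> fst LY) [0..<n * n]
     @ map (\<lambda>p. (p div n, p mod n) \<in> snd LY) [0..<n * n]"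

lemma decode_poset_code:
  assumes "length y = 2 * (n * n)"
  shows "decode n y =
    (linear_of (pair_word (poset_code n r) y), choice_of (pair_word (poset_code n r) y))"
proof -
  let ?w = "pair_word (poset_code n r) y"
  have "entry ?w (n + 2 + n ^ 2) i j \<longleftrightarrow> y ! (i * n + j)" if "i < n" "j < n" for i j
    using matrix_index_less[OF that] assms
    by (simp add: entry_def unary_prefix_poset_code cell_pair_word length_poset_code power2_eq_square)
  moreover have "entry ?w (n + 2 + 2 * n ^ 2) i j \<longleftrightarrow> y ! (n * n + (i * n + j))"
    if "i < n" "j < n" for i j
  proof -
    have "n + 2 + 2 * n ^ 2 + (i * n + j) = (n + 1 + n * n) + 1 + (n * n + (i * n + j))"
      by (simp add: power2_eq_square)
    moreover have "n * n + (i * n + j) < length y"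
      using matrix_index_less[OF that] assms by simp
    ultimately show ?thesis
      by (simp add: entry_def unary_prefix_poset_code cell_pair_word length_poset_code)
  qed
  ultimately show ?thesis
    unfolding decode_def linear_of_def choice_of_def unary_prefix_poset_code by auto
qed

lemma decode_encode:
  assumes "L \<subseteq> {..<n} \<times> {..<n}" "Y \<subseteq> {..<n} \<times> {..<n}"
  shows "decode n (encode n (L, Y)) = (L, Y)"
proof -
  have "encode n (L, Y) ! (i * n + j) \<longleftrightarrow> (i, j) \<in> L"
    "encode n (L, Y) ! (n * n + (i * n + j)) \<longleftrightarrow> (i, j) \<in> Y" if "i < n" "j < n" for i j
    using matrix_index_less[OF that] that by (simp_all add: encode_def nth_append)
  then have "decode n (encode n (L, Y)) =
    ({(i, j). i < n \<and> j < n \<and> (i, j) \<in> L}, {(i, j). i < n \<and> j < n \<and> (i, j) \<in> Y})"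
    unfolding decode_def by (simp cong: conj_cong)
  then show ?thesis using assms by auto
qed

lemma encode_decode:
  assumes "length y = 2 * (n * n)"
  shows "encode n (decode n y) = y"
proof (rule nth_equalityI)
  show "length (encode n (decode n y)) = length y" by (simp add: encode_def assms)
  fix p assume "p < length (encode n (decode n y))"
  then have p: "p < 2 * (n * n)" by (simp add: encode_def)
  have idx: "q div n < n \<and> q mod n < n" if "q < n * n" for q
  proof -
    have "0 < n" using that by (cases n) auto
    then show ?thesis using that by (simp add: less_mult_imp_div_less)
  qed
  show "encode n (decode n y) ! p = y ! p"
  proof (cases "p < n * n")
    case True
    then show ?thesis using idx[OF True] by (simp add: encode_def decode_def nth_append)
  next
    case False
    then have "p - n * n < n * n" using p by simp
    then show ?thesis using idx[of "p - n * n"] False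
      by (simp add: encode_def decode_def nth_append)
  qed
qed

lemma minimals_cong:
  "B \<subseteq> A \<Longrightarrow> (\<And>i j. i \<in> A \<Longrightarrow> j \<in> A \<Longrightarrow> r i j = s i j) \<Longrightarrow> minimals B r = minimals B s"
  unfolding minimals_def by blast

text \<open>Transfers witnesses from \<open>order_of\<close> to the given order, as the two agree
  only on the ground set.\<close>

lemma witness_cong:
  assumes "\<And>i j. i \<in> A \<Longrightarrow> j \<in> A \<Longrightarrow> r i j = s i j"
  shows "witness A r L Y = witness A s L Y"
proof -
  have "non_least (insert x {z\<in>A. (x, z) \<in> L}) r x y = non_least (insert x {z\<in>A. (x, z) \<in> L}) s x y"
    if "x \<in> A" "y \<in> A" for x y
  proof -
    let ?B = "insert x {z\<in>A. (x, z) \<in> L}"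
    have B: "?B \<subseteq> A" using that by blast
    then have "z \<in> A" if "z \<in> minimals ?B s" for z
      using that unfolding minimals_def by blast
    moreover have "minimals ?B r = minimals ?B s"
      by (rule minimals_cong[OF B]) (rule assms)
    ultimately show ?thesis
      unfolding non_least_def using assms[OF _ that(2)] by (metis (no_types, lifting))
  qed
  then show ?thesis
    unfolding witness_def using assms by (simp cong: ball_cong bex_cong)
qed

lemma finite_poset_cong:
  assumes "\<And>i j. i \<in> A \<Longrightarrow> j \<in> A \<Longrightarrow> r i j = s i j"
  shows "finite_poset A r = finite_poset A s"
  unfolding finite_poset_def irreflp_on_def transp_on_def using assms
  by (simp cong: ball_cong)

section \<open>The counting relation\<close>

definition counted :: "bool list \<Rightarrow> bool list \<Rightarrow> bool" where
  "counted x y \<longleftrightarrow> sat (pair_word x y) 2 witness_fm (start_val (pair_word x y))"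

lemma counted_iff:
  assumes "finite_poset {..<n} r"
  shows "counted (poset_code n r) y \<longleftrightarrow>
    length y = 2 * (n * n) \<and> (case decode n y of (L, Y) \<Rightarrow> witness {..<n} r L Y)"
proof -
  let ?w = "pair_word (poset_code n r) y"
  have eq: "order_of ?w i j = r i j" if "i \<in> {..<n}" "j \<in> {..<n}" for i j
    using that order_of_poset_code by simp
  have "shape ?w \<longleftrightarrow> length y = 2 * (n * n)"
    by (simp add: shape_pair_word unary_prefix_poset_code length_poset_code nth_poset_code)
  moreover have "finite_poset {..<n} (order_of ?w)"
    using finite_poset_cong[of "{..<n}" "order_of ?w" r] eq assms by simp
  moreover have "witness {..<n} (order_of ?w) L Y = witness {..<n} r L Y" for L Y
    using eq by (rule witness_cong)
  ultimately show ?thesis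
    unfolding counted_def sat_witness_fm unary_prefix_poset_code
    using decode_poset_code[of y n r] by auto
qed

lemma card_counted:
  assumes "finite_poset {..<n} r"
  shows "card {y. counted (poset_code n r) y} = num_witness {..<n} r"
proof -
  have sub: "L \<subseteq> {..<n} \<times> {..<n} \<and> Y \<subseteq> {..<n} \<times> {..<n}" if "witness {..<n} r L Y" for L Y
  proof
    note w = that[unfolded witness_def]
    show "L \<subseteq> {..<n} \<times> {..<n}" using w[THEN conjunct1] by (rule linorder_rel_subset)
    show "Y \<subseteq> {..<n} \<times> {..<n}" using w[THEN conjunct2, THEN conjunct1] .
  qed
  have "bij_betw (decode n) {y. counted (poset_code n r) y} {(L, Y). witness {..<n} r L Y}"
  proof (rule bij_betw_byWitness[where f' = "encode n"])
    show "\<forall>y\<in>{y. counted (poset_code n r) y}. encode n (decode n y) = y"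
      by (simp add: counted_iff[OF assms] encode_decode)
    show "\<forall>LY\<in>{(L, Y). witness {..<n} r L Y}. decode n (encode n LY) = LY"
    proof clarify
      fix L Y assume "witness {..<n} r L Y"
      with sub show "decode n (encode n (L, Y)) = (L, Y)" by (intro decode_encode) blast+
    qed
    show "decode n ` {y. counted (poset_code n r) y} \<subseteq> {(L, Y). witness {..<n} r L Y}"
      by (rule image_subsetI) (simp only: mem_Collect_eq counted_iff[OF assms])
    show "encode n ` {(L, Y). witness {..<n} r L Y} \<subseteq> {y. counted (poset_code n r) y}"
    proof clarify
      fix L Y assume w: "witness {..<n} r L Y"
      with sub have "decode n (encode n (L, Y)) = (L, Y)" by (intro decode_encode) blast+
      moreover have "length (encode n (L, Y)) = 2 * (n * n)" by (simp add: encode_def)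
      ultimately show "counted (poset_code n r) (encode n (L, Y))"
        using w by (simp add: counted_iff[OF assms])
    qed
  qed
  then show ?thesis unfolding num_witness_def by (rule bij_betw_same_card)
qed

text \<open>Serves twice: only codes of posets have witnesses, which gives the value
  \<open>0\<close> elsewhere, and the witness length \<open>2 * (n * n)\<close> is at most
  \<open>2 * length x\<close>, which gives the polynomial bound.\<close>

lemma counted_shape:
  assumes "counted x y"
  obtains n r where "finite_poset {..<n} r" "x = poset_code n r" "length y \<le> 2 * length x"
proof -
  let ?w = "pair_word x y" and ?n = "unary_prefix (pair_word x y)"
  let ?r = "\<lambda>i j. x ! (?n + 1 + (i * ?n + j))"
  have "shape ?w" and fp: "finite_poset {..<?n} (order_of ?w)"
    using assms unfolding counted_def sat_witness_fm by blast+
  then have x: "length x = ?n + 1 + ?n * ?n" "\<And>i. i < ?n \<Longrightarrow> x ! i" "\<not> x ! ?n"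
    and y: "length y = 2 * (?n * ?n)"
    unfolding shape_pair_word by blast+
  have code: "x = poset_code ?n ?r" using x by (rule poset_code_eqI)
  have "order_of ?w i j = ?r i j" if "i \<in> {..<?n}" "j \<in> {..<?n}" for i j
    using matrix_index_less[of i ?n j] that x(1) by (simp add: order_of_def entry_def cell_pair_word)
  then have "finite_poset {..<?n} ?r"
    using fp finite_poset_cong[of "{..<?n}" "order_of ?w" ?r] by blast
  moreover have "length y \<le> 2 * length x" using x(1) y by simp
  ultimately show ?thesis using that code by blast
qed

theorem theorem1p11:
  "\<exists>f \<in> SharpP.
     (\<forall>n r. finite_poset {..<n} r \<longrightarrow> int (f (poset_code n r)) = xi {..<n} r) \<and>
     (\<forall>w. (\<nexists>n r. finite_poset {..<n} r \<and> w = poset_code n r) \<longrightarrow> f w = 0)"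
proof (rule bexI[of _ "\<lambda>x. card {y. counted x y}"], intro conjI allI impI)
  fix n and r :: "nat \<Rightarrow> nat \<Rightarrow> bool"
  assume "finite_poset {..<n} r"
  from card_counted[OF this] arg_cong[OF num_linext_prod_upper_size[OF this], of int]
  show "int (card {y. counted (poset_code n r) y}) = xi {..<n} r"
    unfolding xi_def by simp
next
  fix w assume "\<nexists>n r. finite_poset {..<n} r \<and> w = poset_code n r"
  then have "{y. counted w y} = {}" using counted_shape by blast
  then show "card {y. counted w y} = 0" by simp
next
  have "poly_time_decidable counted"
    using poly_time_decidable_sat[OF fm_ok_witness_fm] unfolding counted_def by simp
  moreover have "length y \<le> poly [:0, 2:] (length x)" if "counted x y" for x y
    by (rule counted_shape[OF that]) simp
  ultimately show "(\<lambda>x. card {y. counted x y}) \<in> SharpP"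
    unfolding SharpP_def by blast
qed

end
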